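(* Let $G$ be a barbell graph $B(t,\ell)$ with $\ell\in\{2,3,4,5\}$, so that $|V(G)|=n=2t+\ell-2$. Let $c_i$ be the coefficient of $x^i$ in $\det(D(G)-xI)$, where $D(G)$ is the distance matrix of $G$. Then the sequence of coefficients of the distance characteristic polynomial of $G$, taken as $(-1)^{n-1}c_0,\ldots,(-1)^{n-1}c_{n-2}$, is unimodal with peak at $t-1$ if $\ell=2$ and at $t$ if $\ell\in\{3,4,5\}$.
   Context: The barbell graph $B(t,\ell)$ is obtained by connecting two disjoint cliques $K_t$ (complete graphs on $t$ vertices) with a path on $\ell$ vertices, by identifying one end-vertex of the path with a vertex of the first clique and the other end-vertex with a vertex of the second clique. The distance matrix $D(G)$ of a connected graph $G$ has $(u,v)$-entry equal to the length of a shortest path between $u$ and $v$. The distance characteristic polynomial of $G$ is $\det(xI-D(G))=(-1)^n\det(D(G)-xI)$. A finite real sequence $a_0,\ldots,a_N$ is unimodal with peak at $m$ if $a_{i-1}\le a_i$ for all $1\le i\le m$ and $a_i\ge a_{i+1}$ for all $m\le i\le N-1$.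
   Formalization: For ℓ=5 the formal theorem assumes t≥3: the claim fails for B(1,5)=P_5 (sequence 32,120,140,50, peak at 2, not 1) and B(2,5)=P_7 (192,1120,2464,2520,1176,196, peak at 3, not 2); no other case is excluded. *)

theory Defs
  imports Graph_Theory.Graph_Theory Jordan_Normal_Form.Char_Poly Complex_Main
begin

text \<open>
  Finite simple graphs are the symmetric, loop-free digraphs without parallel arcs of
  \<^locale>\<open>graph\<close>; an edge between \<open>u\<close> and \<open>v\<close> is represented by the two ordered pairs
  \<open>(u, v)\<close> and \<open>(v, u)\<close> in \<^const>\<open>arcs_ends\<close>.
\<close>

definition clique_ends :: "'a set \<Rightarrow> ('a \<times> 'a) set" where
  "clique_ends A = {(u, v). u \<in> A \<and> v \<in> A \<and> u \<noteq> v}"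

definition path_ends :: "'a list \<Rightarrow> ('a \<times> 'a) set" where
  "path_ends p = {(p ! i, p ! Suc i) | i. Suc i < length p} \<union>
                 {(p ! Suc i, p ! i) | i. Suc i < length p}"

text \<open>
  \<open>G\<close> is, up to the names of its vertices, the barbell graph \<open>B(t, l)\<close>: \<open>A\<close> and \<open>B\<close> are the
  vertex sets of the two cliques and \<open>p\<close> lists the \<open>l\<close> vertices of the path in order.
  The end-vertices of \<open>p\<close> are the identified ones, so they lie in \<open>A\<close> and \<open>B\<close> and only the
  \<open>l - 2\<close> inner vertices of \<open>p\<close> are outside the cliques. The conditions force
  \<open>t \<ge> 1\<close> and \<open>l \<ge> 2\<close>.
\<close>

definition barbell_graph :: "nat \<Rightarrow> nat \<Rightarrow> ('a, 'b) pre_digraph \<Rightarrow> bool" where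
  "barbell_graph t l G \<longleftrightarrow> graph G \<and>
     (\<exists>A B p. card A = t \<and> card B = t \<and> A \<inter> B = {} \<and>
        p \<noteq> [] \<and> distinct p \<and> length p = l \<and>
        A \<inter> set p = {hd p} \<and> B \<inter> set p = {last p} \<and>
        verts G = A \<union> B \<union> set p \<and>
        arcs_ends G = clique_ends A \<union> clique_ends B \<union> path_ends p)"

text \<open>
  Every arc has cost 1, so the cost of a walk is its length; the infimum over walks
  in \<^const>\<open>wf_digraph.\<mu>\<close> is attained by a shortest path when the graph is connected.
\<close>

definition graph_dist :: "('a, 'b) pre_digraph \<Rightarrow> 'a \<Rightarrow> 'a \<Rightarrow> real" where
  "graph_dist G u v = real_of_ereal (wf_digraph.\<mu> G (\<lambda>_. 1) u v)"

text \<open>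
  The list \<open>vs\<close> enumerates the vertices without repetition and fixes the order of the
  rows and columns.
\<close>

definition distance_matrix :: "('a, 'b) pre_digraph \<Rightarrow> 'a list \<Rightarrow> real mat" where
  "distance_matrix G vs =
     mat (length vs) (length vs) (\<lambda>(i, j). graph_dist G (vs ! i) (vs ! j))"

text \<open>
  The polynomial \<open>det (D - x I)\<close>. It differs by the factor \<open>(-1) ^ n\<close> from \<^const>\<open>char_poly\<close>,
  which is \<open>det (x I - D)\<close>.
\<close>

definition det_minus_x :: "real mat \<Rightarrow> real poly" where
  "det_minus_x D = det (map_mat (\<lambda>a. [:a:]) D - [:0, 1:] \<cdot>\<^sub>m 1\<^sub>m (dim_row D))"

text \<open>
  The finite sequence \<open>a 0, \<dots>, a N\<close> is unimodal with peak at the index \<open>m\<close>; values of \<open>a\<close>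
  beyond \<open>N\<close> are irrelevant.
\<close>

definition unimodal_with_peak :: "(nat \<Rightarrow> real) \<Rightarrow> nat \<Rightarrow> nat \<Rightarrow> bool" where
  "unimodal_with_peak a N m \<longleftrightarrow> m \<le> N \<and>
     (\<forall>i. 1 \<le> i \<and> i \<le> m \<longrightarrow> a (i - 1) \<le> a i) \<and>
     (\<forall>i. m \<le> i \<and> i < N \<longrightarrow> a i \<ge> a (i + 1))"

end

theory Submission
  imports Defs
begin

text \<open>
  Number the vertices of the barbell graph by layers along its axis: the free vertices of the first
  clique, the \<open>l\<close> path vertices one by one, the free vertices of the second clique. Two vertices
  are adjacent exactly when they are distinct and their layers differ by at most one, so distances
  are differences of layers, except that distinct vertices of one layer have distance 1. Hence \<open>D + I\<close>
  depends only on the layers of its row and column, and the determinant identity of Sylvester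
  (\<open>quotient_det\<close>) turns, for \<open>t \<ge> 2\<close>, \<open>det (x I - D)\<close> into a power of \<open>x + 1\<close> times a determinant of size
  \<open>l + 2\<close>. This small matrix is invariant under the reflection of the graph, so it splits into a
  symmetric and an antisymmetric half (\<open>centrosymmetric_det\<close>), each of size at most 4, and
  \<open>det (x I - D) = - (1 + x) ^ (2 t - 4) q\<close> for an explicit polynomial \<open>q\<close> (\<open>barbell_factor\<close>).

  The sequence in question consists of the coefficients of \<open>(1 + x) ^ (2 t - 4) q\<close>. Since \<open>D\<close> is
  symmetric, this polynomial has only real roots, so by the inequality of Newton
  (\<open>newton_inequality\<close>) its coefficients are log-concave. All coefficients up to the index
  \<open>n - 2\<close> are positive (\<open>barbell_factor_coeffs_pos\<close>): only the leading coefficient of \<open>q\<close> is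
  negative, and it is outweighed by the one before it. A positive log-concave sequence cannot rise
  again after it has stopped rising (\<open>log_concave_unimodal\<close>), so it only remains to compare the
  claimed peak with its two neighbours. There the coefficients are combinations of the binomial
  coefficients \<open>2 m choose (m + k)\<close> with \<open>m = t - 2\<close> and \<open>\<bar>k\<bar> \<le> 6\<close>. These are the values of
  polynomials in \<open>m\<close>, up to a common positive factor (\<open>central_binomial_ratio\<close>), and the two
  comparisons become inequalities between polynomials in \<open>m\<close>, or in \<open>m - 1\<close> if \<open>l = 5\<close>, which
  hold coefficient by coefficient.

  For \<open>t = 1\<close> the graph is a path with at most four vertices and its polynomial is written out.
\<close>

section \<open>Polynomials with only real roots\<close>

abbreviation cpx :: "real poly \<Rightarrow> complex poly" where "cpx \<equiv> map_poly complex_of_real"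

definition real_rooted :: "real poly \<Rightarrow> bool" where
  "real_rooted p \<longleftrightarrow> (\<forall>z. poly (cpx p) z = 0 \<longrightarrow> Im z = 0)"

text \<open>
  \<open>p' / p\<close> is the sum of \<open>1 / (z - a)\<close> over the roots \<open>a\<close>. For real \<open>a\<close> all these terms lie in
  the half plane opposite to that of \<open>z\<close>, so they cannot cancel.
\<close>

lemma log_derivative_half_plane:
  fixes as :: "complex list" and z :: complex
  assumes "\<And>a. a \<in> set as \<Longrightarrow> Im a = 0" and "Im z \<noteq> 0"
  defines "p \<equiv> (\<Prod>a\<leftarrow>as. [:- a, 1:])"
  shows "poly p z \<noteq> 0"
    and "as \<noteq> [] \<Longrightarrow> Im z * Im (poly (pderiv p) z / poly p z) < 0"
proof -
  have "poly p z \<noteq> 0 \<and>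
    (if as = [] then pderiv p = 0 else Im z * Im (poly (pderiv p) z / poly p z) < 0)"
    using assms(1) unfolding p_def
  proof (induction as)
    case Nil
    then show ?case by simp
  next
    case (Cons a as)
    let ?q = "\<Prod>a\<leftarrow>as. [:- a, 1:]"
    have za: "z - a \<noteq> 0" using Cons.prems assms(2) by force
    have q: "poly ?q z \<noteq> 0" using Cons by simp
    have le: "Im z * Im (poly (pderiv ?q) z / poly ?q z) \<le> 0"
      using Cons by (cases "as = []") (auto simp: less_imp_le)
    have "poly (pderiv ([:- a, 1:] * ?q)) z / poly ([:- a, 1:] * ?q) z
        = 1 / (z - a) + poly (pderiv ?q) z / poly ?q z"
      using za q unfolding pderiv_mult poly_add poly_mult
      by (simp add: pderiv_pCons add_divide_distrib)
    moreover have "Im z * Im (1 / (z - a)) < 0"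
    proof -
      have "Im (1 / (z - a)) = - Im z / (cmod (z - a))\<^sup>2"
        using Cons.prems by (simp add: Im_divide cmod_power2)
      then show ?thesis using za assms(2)
        by (simp add: power2_eq_square[symmetric] divide_neg_pos)
    qed
    ultimately have "Im z * Im (poly (pderiv ([:- a, 1:] * ?q)) z / poly ([:- a, 1:] * ?q) z) < 0"
      using le by (simp add: distrib_left)
    moreover have "poly ([:- a, 1:] * ?q) z \<noteq> 0" using za q by simp
    ultimately show ?case by simp
  qed
  then show "poly p z \<noteq> 0" "as \<noteq> [] \<Longrightarrow> Im z * Im (poly (pderiv p) z / poly p z) < 0"
    by auto
qed

lemma real_rooted_factors:
  assumes "real_rooted p"
  obtains as where "\<And>a. a \<in> set as \<Longrightarrow> Im a = 0"
    and "cpx p = Polynomial.smult (lead_coeff (cpx p)) (\<Prod>a\<leftarrow>as. [:- a, 1:])" and "length as = degree p"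
proof -
  obtain as where as: "Polynomial.smult (lead_coeff (cpx p)) (\<Prod>a\<leftarrow>as. [:- a, 1:]) = cpx p"
    and len: "length as = degree (cpx p)"
    using fundamental_theorem_algebra_factorized[of "cpx p"] by blast
  have "Im a = 0" if "a \<in> set as" for a
  proof -
    have "poly (\<Prod>a\<leftarrow>as. [:- a, 1:]) a = 0"
      using that by (auto simp: poly_prod_list prod_list_zero_iff)
    then have "poly (cpx p) a = 0" by (subst as[symmetric]) simp
    then show ?thesis using assms by (simp add: real_rooted_def)
  qed
  then show ?thesis using as len that by (metis of_real_hom.degree_map_poly_hom)
qed

lemma real_rooted_pderiv:
  assumes "real_rooted p" and "degree p \<noteq> 0"
  shows "real_rooted (pderiv p)"
  unfolding real_rooted_def
proof (intro allI impI, rule ccontr)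
  fix z assume z: "poly (cpx (pderiv p)) z = 0" and nz: "Im z \<noteq> 0"
  obtain as where as: "\<And>a. a \<in> set as \<Longrightarrow> Im a = 0"
    and p: "cpx p = Polynomial.smult (lead_coeff (cpx p)) (\<Prod>a\<leftarrow>as. [:- a, 1:])" and len: "length as = degree p"
    using real_rooted_factors[OF assms(1)] by metis
  have "pderiv (cpx p) = cpx (pderiv p)"
    by (intro poly_eqI) (simp add: coeff_pderiv coeff_map_poly)
  then have "cpx (pderiv p) = Polynomial.smult (lead_coeff (cpx p)) (pderiv (\<Prod>a\<leftarrow>as. [:- a, 1:]))"
    using p by (metis pderiv_smult)
  then have "lead_coeff (cpx p) * poly (pderiv (\<Prod>a\<leftarrow>as. [:- a, 1:])) z = 0"
    using z by simp
  then have "poly (pderiv (\<Prod>a\<leftarrow>as. [:- a, 1:])) z = 0"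
    using assms(2) by auto
  moreover have "as \<noteq> []" using len assms(2) by auto
  ultimately show False using log_derivative_half_plane(2)[OF as nz] by fastforce
qed

text \<open>
  Away from the roots the claim says that \<open>p' / p\<close>, a sum of terms \<open>1 / (x - b)\<close> with real
  \<open>b\<close>, has a nonpositive derivative. The induction over the factors proves this without
  dividing by \<open>p\<close>: a new factor \<open>x - b\<close> changes \<open>p' ^ 2 - p p''\<close> into \<open>(x - b) ^ 2\<close> times
  it plus \<open>p ^ 2\<close>.
\<close>

lemma laguerre_inequality:
  fixes x :: real
  assumes "real_rooted p"
  shows "poly p x * poly (pderiv (pderiv p)) x \<le> (poly (pderiv p) x)\<^sup>2"
proof -
  obtain as where as: "\<And>a. a \<in> set as \<Longrightarrow> Im a = 0"
    and p: "cpx p = Polynomial.smult (lead_coeff (cpx p)) (\<Prod>a\<leftarrow>as. [:- a, 1:])"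
    using real_rooted_factors[OF assms] by metis
  define q where "q = (\<Prod>b\<leftarrow>map Re as. [:- b, 1:])"
  have "cpx (\<Prod>b\<leftarrow>map Re as. [:- b, 1:]) = (\<Prod>a\<leftarrow>as. [:- a, 1:])" using as
  proof (induction as)
    case (Cons a as)
    have "cpx ([:- Re a, 1:] * r) = [:- a, 1:] * cpx r" for r
      using Cons.prems[of a] by (intro poly_eqI) (auto simp: coeff_pCons complex_eq_iff coeff_map_poly split: nat.split)
    then show ?case using Cons by simp
  qed simp
  then have eq: "cpx p = cpx (Polynomial.smult (lead_coeff p) q)"
    using p by (simp add: q_def of_real_hom.map_poly_hom_smult)
  have "p = Polynomial.smult (lead_coeff p) q"
  proof (intro poly_eqI)
    fix i
    have "coeff (cpx p) i = coeff (cpx (Polynomial.smult (lead_coeff p) q)) i" using eq by (rule arg_cong)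
    then show "coeff p i = coeff (Polynomial.smult (lead_coeff p) q) i"
      unfolding of_real_hom.coeff_map_poly_hom of_real_eq_iff .
  qed
  then obtain c where pq: "p = Polynomial.smult c q" by blast
  have "poly q x * poly (pderiv (pderiv q)) x \<le> (poly (pderiv q) x)\<^sup>2"
    unfolding q_def
  proof (induction as)
    case Nil
    then show ?case by simp
  next
    case (Cons a as)
    define r where "r = (\<Prod>b\<leftarrow>map Re as. [:- b, 1:])"
    define l where "l = [:- Re a, 1:]"
    have d: "poly (pderiv (l * r)) x = poly r x + (x - Re a) * poly (pderiv r) x"
      "poly (pderiv (pderiv (l * r))) x = 2 * poly (pderiv r) x + (x - Re a) * poly (pderiv (pderiv r)) x"
      unfolding pderiv_mult pderiv_add poly_add poly_mult
      by (simp_all add: l_def pderiv_pCons algebra_simps)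
    have "(x - Re a)\<^sup>2 * (poly r x * poly (pderiv (pderiv r)) x) \<le> (x - Re a)\<^sup>2 * (poly (pderiv r) x)\<^sup>2"
      using Cons by (intro mult_left_mono) (simp_all add: r_def)
    note base = this
    have e: "poly (l * r) x = (x - Re a) * poly r x"
      by (simp add: l_def algebra_simps)
    have "poly (l * r) x * poly (pderiv (pderiv (l * r))) x
       \<le> (poly (pderiv (l * r)) x)\<^sup>2 - (poly r x)\<^sup>2"
      unfolding d e using base by (simp add: algebra_simps power2_eq_square)
    then have "poly (l * r) x * poly (pderiv (pderiv (l * r))) x \<le> (poly (pderiv (l * r)) x)\<^sup>2"
      using zero_le_power2[of "poly r x"] by linarith
    then show ?case unfolding r_def l_def by simp
  qed
  then have "c\<^sup>2 * (poly q x * poly (pderiv (pderiv q)) x) \<le> c\<^sup>2 * (poly (pderiv q) x)\<^sup>2"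
    by (intro mult_left_mono) simp_all
  then show ?thesis
    unfolding pq pderiv_smult poly_smult by (simp add: power2_eq_square mult.commute mult.left_commute)
qed

text \<open>
  For \<open>k = 0\<close> this is the inequality of Laguerre at the origin. The general case is the same
  statement for the \<open>k\<close>-th derivative, which again has only real roots.
\<close>

lemma newton_inequality:
  assumes "real_rooted p"
  shows "real (k + 2) * (coeff p k * coeff p (k + 2)) \<le> real (k + 1) * (coeff p (k + 1))\<^sup>2"
  using assms
proof (induction k arbitrary: p)
  case 0
  have "coeff (pderiv p) 0 = coeff p 1" "coeff (pderiv (pderiv p)) 0 = 2 * coeff p 2"
    by (simp_all add: coeff_pderiv numeral_2_eq_2)
  then show ?case using laguerre_inequality[OF 0, of 0]
    by (simp add: poly_0_coeff_0 algebra_simps numeral_2_eq_2)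
next
  case (Suc k)
  show ?case
  proof (cases "degree p = 0")
    case True
    then show ?thesis by (simp add: coeff_eq_0)
  next
    case False
    have "real (k + 2) * (coeff (pderiv p) k * coeff (pderiv p) (k + 2))
      \<le> real (k + 1) * (coeff (pderiv p) (k + 1))\<^sup>2"
      by (rule Suc.IH[OF real_rooted_pderiv[OF Suc.prems False]])
    then have "(real (k + 2) * real (k + 1)) * (real (k + 3) * (coeff p (k + 1) * coeff p (k + 3)))
      \<le> (real (k + 2) * real (k + 1)) * (real (k + 2) * (coeff p (k + 2))\<^sup>2)"
      by (simp add: coeff_pderiv power2_eq_square algebra_simps eval_nat_numeral)
    then have "real (k + 3) * (coeff p (k + 1) * coeff p (k + 3)) \<le> real (k + 2) * (coeff p (k + 2))\<^sup>2"
      by (subst (asm) mult_le_cancel_left_pos) auto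
    then show ?thesis by (simp add: eval_nat_numeral)
  qed
qed

lemma symmetric_char_poly_real_rooted:
  fixes A :: "real mat"
  assumes A: "A \<in> carrier_mat n n"
    and sym: "\<And>i j. i < n \<Longrightarrow> j < n \<Longrightarrow> A $$ (i, j) = A $$ (j, i)"
  shows "real_rooted (char_poly A)"
  unfolding real_rooted_def
proof (intro allI impI)
  fix z assume "poly (cpx (char_poly A)) z = 0"
  define B where "B = map_mat complex_of_real A"
  have B: "B \<in> carrier_mat n n" using A by (simp add: B_def)
  have "poly (char_poly B) z = 0"
    unfolding B_def of_real_hom.char_poly_hom[OF A] by fact
  then obtain v where v: "v \<in> carrier_vec n" "v \<noteq> 0\<^sub>v n" "B *\<^sub>v v = z \<cdot>\<^sub>v v"
    using eigenvalue_root_char_poly[OF B] B by (auto simp: eigenvalue_def eigenvector_def)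
  have ev: "(\<Sum>j<n. of_real (A $$ (i, j)) * v $ j) = z * v $ i" if "i < n" for i
    using arg_cong[OF v(3), of "\<lambda>w. w $ i"] that v(1) A
    by (simp add: B_def scalar_prod_def atLeast0LessThan)
  define N where "N = (\<Sum>i<n. cnj (v $ i) * v $ i)"
  have Nr: "N = of_real (\<Sum>i<n. (cmod (v $ i))\<^sup>2)"
    unfolding N_def by (simp add: complex_norm_square[symmetric] mult.commute[of "cnj _"] del: of_real_power)
  obtain i where i: "i < n" "v $ i \<noteq> 0" using v(1,2) by (metis eq_vecI carrier_vecD index_zero_vec)
  have "0 < (cmod (v $ i))\<^sup>2" using i by simp
  also have "\<dots> \<le> (\<Sum>i<n. (cmod (v $ i))\<^sup>2)"
    using i by (intro member_le_sum) auto
  finally have N0: "N \<noteq> 0" unfolding Nr using of_real_eq_0_iff by force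
  \<comment> \<open>the quadratic form of \<open>v\<close> is evaluated with the matrix acting on either side\<close>
  have "z * N = (\<Sum>i<n. \<Sum>j<n. cnj (v $ i) * (of_real (A $$ (i, j)) * v $ j))"
    unfolding N_def sum_distrib_left[symmetric]
    by (simp add: sum_distrib_left ev mult.left_commute)
  also have "\<dots> = (\<Sum>j<n. \<Sum>i<n. cnj (v $ i) * (of_real (A $$ (i, j)) * v $ j))"
    by (rule sum.swap)
  also have "\<dots> = (\<Sum>j<n. v $ j * cnj (\<Sum>i<n. of_real (A $$ (j, i)) * v $ i))"
    by (auto intro!: sum.cong simp: sum_distrib_left sym)
  also have "\<dots> = (\<Sum>j<n. v $ j * cnj (z * v $ j))"
    by (rule sum.cong) (simp_all only: ev lessThan_iff)
  also have "\<dots> = cnj z * N"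
    unfolding N_def sum_distrib_left by (rule sum.cong) simp_all
  finally have "z = cnj z" using N0 by simp
  then show "Im z = 0" by (simp add: complex_eq_iff)
qed

section \<open>Determinants of quotient and of centrosymmetric matrices\<close>

lemma det_unipotent:
  fixes A :: "'a :: comm_ring_1 mat"
  assumes "A \<in> carrier_mat n n" and "\<And>i. i < n \<Longrightarrow> A $$ (i, i) = 1"
    and "\<And>i j. j < i \<Longrightarrow> i < n \<Longrightarrow> A $$ (i, j) = 0"
  shows "det A = 1"
proof -
  have "det A = prod_list (diag_mat A)"
    using assms by (intro det_upper_triangular[of _ n]) (auto intro!: upper_triangularI)
  also have "\<dots> = 1"
    using assms(1,2) by (auto simp: prod_list_diag_prod)
  finally show ?thesis .
qed

text \<open>
  Eliminating either off-diagonal block of the matrix with rows \<open>(y I, A)\<close> and \<open>(B, I)\<close>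
  computes its determinant in two ways.
\<close>

lemma sylvester_det:
  fixes A B :: "'a :: idom mat"
  assumes A: "A \<in> carrier_mat n k" and B: "B \<in> carrier_mat k n"
  shows "y ^ k * det (y \<cdot>\<^sub>m 1\<^sub>m n - A * B) = y ^ n * det (y \<cdot>\<^sub>m 1\<^sub>m k - B * A)"
proof -
  let ?M = "four_block_mat (y \<cdot>\<^sub>m 1\<^sub>m n) A B (1\<^sub>m k)"
  let ?L = "four_block_mat (1\<^sub>m n) (0\<^sub>m n k) (- B) (y \<cdot>\<^sub>m 1\<^sub>m k)"
  let ?R = "four_block_mat (1\<^sub>m n) (0\<^sub>m n k) (- B) (1\<^sub>m k)"
  have M: "?M \<in> carrier_mat (n + k) (n + k)" and L: "?L \<in> carrier_mat (n + k) (n + k)"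
    and R: "?R \<in> carrier_mat (n + k) (n + k)"
    using A B by auto
  have "?M * ?R = four_block_mat (y \<cdot>\<^sub>m 1\<^sub>m n - A * B) A (0\<^sub>m k n) (1\<^sub>m k)"
    using A B by (subst mult_four_block_mat[of _ n n _ k _ k _ _ n _ k]) (auto simp: minus_add_uminus_mat)
  then have "det ?M * det ?R = det (y \<cdot>\<^sub>m 1\<^sub>m n - A * B)"
    using det_mult[OF M R] A B
    by (simp add: det_four_block_mat_lower_left_zero[of _ n _ k] minus_carrier_mat mult_carrier_mat[of A n k B n])
  moreover have "det ?R = 1"
    using B by (simp add: det_four_block_mat_upper_right_zero[of _ n _ k])
  ultimately have 1: "det ?M = det (y \<cdot>\<^sub>m 1\<^sub>m n - A * B)" by simp
  have "?L * ?M = four_block_mat (y \<cdot>\<^sub>m 1\<^sub>m n) A (0\<^sub>m k n) (y \<cdot>\<^sub>m 1\<^sub>m k - B * A)"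
    using A B by (subst mult_four_block_mat[of _ n n _ k _ k _ _ n _ k]) (auto simp: minus_add_uminus_mat)
  then have "det ?L * det ?M = y ^ n * det (y \<cdot>\<^sub>m 1\<^sub>m k - B * A)"
    using det_mult[OF L M] A B
    by (simp add: det_four_block_mat_lower_left_zero[of _ n _ k] minus_carrier_mat mult_carrier_mat[of B k n A k])
  moreover have "det ?L = y ^ k"
    using B by (simp add: det_four_block_mat_upper_right_zero[of _ n _ k])
  ultimately show ?thesis using 1 by simp
qed

text \<open>
  A matrix whose entries depend only on the classes \<open>cl i\<close> and \<open>cl j\<close> factors through the class
  indicators. Exchanging the two factors leaves one row and one column for each class, the
  column weighted by the size of its class.
\<close>

lemma quotient_det:
  fixes w :: "nat \<Rightarrow> nat \<Rightarrow> 'a :: idom"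
  assumes cl: "\<And>i. i < n \<Longrightarrow> cl i < k"
  shows "y ^ k * det (mat n n (\<lambda>(i, j). (if i = j then y else 0) - w (cl i) (cl j)))
       = y ^ n * det (mat k k (\<lambda>(a, b). (if a = b then y else 0) - w a b * of_nat (card {i. i < n \<and> cl i = b})))"
proof -
  define A where "A = mat n k (\<lambda>(i, a). if cl i = a then 1 else 0 :: 'a)"
  define B where "B = mat k n (\<lambda>(a, j). w a (cl j))"
  have "mat n n (\<lambda>(i, j). (if i = j then y else 0) - w (cl i) (cl j)) = y \<cdot>\<^sub>m 1\<^sub>m n - A * B"
    using cl by (intro eq_matI) (auto simp: A_def B_def scalar_prod_def if_distrib[of "\<lambda>x. x * _"] cong: if_cong)
  moreover have "mat k k (\<lambda>(a, b). (if a = b then y else 0) - w a b * of_nat (card {i. i < n \<and> cl i = b}))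
      = y \<cdot>\<^sub>m 1\<^sub>m k - B * A"
  proof (intro eq_matI)
    fix a b assume "a < dim_row (y \<cdot>\<^sub>m 1\<^sub>m k - B * A)" "b < dim_col (y \<cdot>\<^sub>m 1\<^sub>m k - B * A)"
    then have ab: "a < k" "b < k" by (simp_all add: A_def B_def)
    have "(\<Sum>i = 0..<n. w a (cl i) * (if cl i = b then 1 else 0)) = (\<Sum>i\<in>{i. i < n \<and> cl i = b}. w a b)"
      by (intro sum.mono_neutral_cong_right) auto
    then show "mat k k (\<lambda>(a, b). (if a = b then y else 0) - w a b * of_nat (card {i. i < n \<and> cl i = b})) $$ (a, b)
      = (y \<cdot>\<^sub>m 1\<^sub>m k - B * A) $$ (a, b)"
      using ab by (simp add: A_def B_def scalar_prod_def mult.commute)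
  qed (simp_all add: A_def B_def)
  ultimately show ?thesis
    using sylvester_det[of A n k B y] by (simp add: A_def B_def)
qed

text \<open>
  Subtracting from each of the first \<open>h\<close> rows its mirror row, and then adding to each of the last
  \<open>h\<close> columns its mirror column, creates a zero block in the upper right corner. The remaining
  diagonal blocks describe the action on antisymmetric and on symmetric vectors. For odd \<open>k\<close>
  the middle row and column belong to the symmetric block and have no mirror image.
\<close>

lemma centrosymmetric_det:
  fixes f :: "nat \<Rightarrow> nat \<Rightarrow> 'a :: idom"
  assumes sym: "\<And>i j. i < k \<Longrightarrow> j < k \<Longrightarrow> f (k - 1 - i) (k - 1 - j) = f i j"
    and k: "k = h + m" "h \<le> m" "m \<le> Suc h"
  shows "det (mat k k (\<lambda>(i, j). f i j))
       = det (mat h h (\<lambda>(i, j). f i j - f (k - 1 - i) j))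
       * det (mat m m (\<lambda>(i, j). f (h + i) (h + j) + (if m \<le> h + j then f (h + i) (m - 1 - j) else 0)))"
proof -
  define M where "M = mat k k (\<lambda>(i, j). f i j)"
  define L where "L = mat k k (\<lambda>(i, j). if i = j then 1 else if i < h \<and> i + j = k - 1 then -1 else 0 :: 'a)"
  define R where "R = mat k k (\<lambda>(i, j). if i = j then 1 else if i < h \<and> i + j = k - 1 then 1 else 0 :: 'a)"
  have c[simp]: "M \<in> carrier_mat k k" "L \<in> carrier_mat k k" "R \<in> carrier_mat k k"
    by (simp_all add: M_def L_def R_def)
  have det1: "det L = 1" "det R = 1"
    using k by (auto intro!: det_unipotent[of _ k] simp: L_def R_def)
  have LM: "L * M = mat k k (\<lambda>(i, j). if i < h then f i j - f (k - 1 - i) j else f i j)"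
  proof (intro eq_matI)
    fix i j assume "i < dim_row (mat k k (\<lambda>(i, j). if i < h then f i j - f (k - 1 - i) j else f i j))"
      "j < dim_col (mat k k (\<lambda>(i, j). if i < h then f i j - f (k - 1 - i) j else f i j))"
    then have ij: "i < k" "j < k" by simp_all
    have "(L * M) $$ (i, j) = (\<Sum>r = 0..<k. (if r = i then f r j else 0)
        - (if r = k - 1 - i then (if i < h then f r j else 0) else 0))"
      using ij k by (auto simp: L_def M_def scalar_prod_def intro!: sum.cong)
    also have "\<dots> = f i j - (if i < h then f (k - 1 - i) j else 0)"
      using ij by (simp add: sum_subtractf)
    finally show "(L * M) $$ (i, j) = mat k k (\<lambda>(i, j). if i < h then f i j - f (k - 1 - i) j else f i j) $$ (i, j)"
      using ij by simp
  qed (simp_all add: L_def M_def)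
  define g where "g i j = (if i < h then f i j - f (k - 1 - i) j else f i j)" for i j
  have LMR: "L * M * R = mat k k (\<lambda>(i, j). g i j + (if m \<le> j then g i (k - 1 - j) else 0))"
  proof (intro eq_matI)
    fix i j assume "i < dim_row (mat k k (\<lambda>(i, j). g i j + (if m \<le> j then g i (k - 1 - j) else 0)))"
      "j < dim_col (mat k k (\<lambda>(i, j). g i j + (if m \<le> j then g i (k - 1 - j) else 0)))"
    then have ij: "i < k" "j < k" by simp_all
    have "(L * M * R) $$ (i, j) = (\<Sum>r = 0..<k. (if r = j then g i r else 0)
        + (if r = k - 1 - j then (if m \<le> j then g i r else 0) else 0))"
      using ij k unfolding LM by (auto simp: R_def g_def scalar_prod_def intro!: sum.cong)
    also have "\<dots> = g i j + (if m \<le> j then g i (k - 1 - j) else 0)"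
      using ij by (simp add: sum.distrib)
    finally show "(L * M * R) $$ (i, j) = mat k k (\<lambda>(i, j). g i j + (if m \<le> j then g i (k - 1 - j) else 0)) $$ (i, j)"
      using ij by simp
  qed (simp_all add: L_def R_def)
  also have "\<dots> = four_block_mat (mat h h (\<lambda>(i, j). f i j - f (k - 1 - i) j)) (0\<^sub>m h m)
      (mat m h (\<lambda>(i, j). f (h + i) j))
      (mat m m (\<lambda>(i, j). f (h + i) (h + j) + (if m \<le> h + j then f (h + i) (m - 1 - j) else 0)))"
  proof -
    have mid: "f i j = f (k - 1 - i) j" if "i < h" "h \<le> j" "j < m" for i j
    proof -
      have "k - 1 - j = j" using that k by auto
      then show ?thesis using sym[of i j] that k by simp
    qed
    have out: "f i (h + m - Suc j) = f (h + m - Suc i) j" if "i < h" "j < h + m" for i j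
      using sym[of "k - 1 - i" j] that k by simp
    have out': "f (h + m - Suc i) (h + m - Suc j) = f i j" if "i < h" "j < h + m" for i j
      using sym[of i j] that k by simp
    show ?thesis
      using k by (intro eq_matI) (auto simp: g_def mid out out' not_less not_le add.commute[of m h])
  qed
  finally have "det (L * M * R) = det (mat h h (\<lambda>(i, j). f i j - f (k - 1 - i) j))
       * det (mat m m (\<lambda>(i, j). f (h + i) (h + j) + (if m \<le> h + j then f (h + i) (m - 1 - j) else 0)))"
    by (simp add: det_four_block_mat_upper_right_zero[of _ h _ m])
  then show ?thesis
    using det1 by (simp add: det_mult[of _ k] M_def[symmetric] mult_carrier_mat[of _ k k])
qed

lemma det_expand_first_row:
  fixes f :: "nat \<Rightarrow> nat \<Rightarrow> 'a :: comm_ring_1"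
  shows "det (mat (Suc n) (Suc n) (\<lambda>(i, j). f i j))
    = (\<Sum>j<Suc n. (-1) ^ j * f 0 j * det (mat n n (\<lambda>(i, c). f (Suc i) (if c < j then c else Suc c))))"
proof -
  let ?A = "mat (Suc n) (Suc n) (\<lambda>(i, j). f i j)"
  have "mat_delete ?A 0 j = mat n n (\<lambda>(i, c). f (Suc i) (if c < j then c else Suc c))" for j
    by (intro eq_matI) (auto simp: mat_delete_def)
  then show ?thesis
    by (subst laplace_expansion_row[of _ "Suc n" 0]) (auto simp: cofactor_def algebra_simps intro!: sum.cong)
qed

section \<open>The quotient matrix of a barbell graph\<close>

definition layer_dist :: "nat \<Rightarrow> nat \<Rightarrow> 'a :: comm_ring_1" where
  "layer_dist i j = of_nat ((i - j) + (j - i))"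

text \<open>
  The matrix to which \<open>quotient_det\<close> reduces \<open>x I - D\<close>, with \<open>y = x + 1\<close> and with \<open>s\<close> free
  vertices in each clique: the outer layers have size \<open>s\<close>, the other layers have size 1. The
  1 added on the diagonal of the distances is the distance between distinct vertices of one layer,
  and at the same time the entry of \<open>D + I\<close> for equal vertices.
\<close>

definition layer_entry :: "nat \<Rightarrow> 'a :: comm_ring_1 \<Rightarrow> 'a \<Rightarrow> nat \<Rightarrow> nat \<Rightarrow> 'a" where
  "layer_entry l s y i j = (if i = j then y else 0)
     - (layer_dist i j + (if i = j then 1 else 0)) * (if j = 0 \<or> j = l + 1 then s else 1)"

lemma layer_entry_symmetric:
  assumes "k = l + 2" and "i < k" "j < k"
  shows "layer_entry l s y (k - 1 - i) (k - 1 - j) = layer_entry l s y i j"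
proof -
  have "(l + 1 - i) - (l + 1 - j) + ((l + 1 - j) - (l + 1 - i)) = (i - j) + (j - i)"
    using assms by auto
  moreover have "l + 1 - i = l + 1 - j \<longleftrightarrow> i = j" "l + 1 - j = 0 \<or> l + 1 - j = l + 1 \<longleftrightarrow> j = 0 \<or> j = l + 1"
    using assms by auto
  moreover have "k - 1 = l + 1" using assms(1) by simp
  ultimately show ?thesis unfolding layer_entry_def layer_dist_def by (simp only:)
qed

lemma det_2:
  fixes f :: "nat \<Rightarrow> nat \<Rightarrow> 'a :: comm_ring_1"
  shows "det (mat 2 2 (\<lambda>(i, j). f i j)) = f 0 0 * f 1 1 - f 0 1 * f 1 0"
  by (simp add: det_expand_first_row numeral_2_eq_2)

lemma det_3:
  fixes f :: "nat \<Rightarrow> nat \<Rightarrow> 'a :: comm_ring_1"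
  shows "det (mat 3 3 (\<lambda>(i, j). f i j))
    = f 0 0 * (f 1 1 * f 2 2 - f 1 2 * f 2 1)
    - f 0 1 * (f 1 0 * f 2 2 - f 1 2 * f 2 0)
    + f 0 2 * (f 1 0 * f 2 1 - f 1 1 * f 2 0)"
proof -
  have Suc: "Suc 0 = 1" "Suc 1 = 2" by simp_all
  have minors:
    "det (mat 2 2 (\<lambda>(i, c). f (Suc i) (if c < 0 then c else Suc c))) = f 1 1 * f 2 2 - f 1 2 * f 2 1"
    "det (mat 2 2 (\<lambda>(i, c). f (Suc i) (if c < 1 then c else Suc c))) = f 1 0 * f 2 2 - f 1 2 * f 2 0"
    "det (mat 2 2 (\<lambda>(i, c). f (Suc i) (if c < 2 then c else Suc c))) = f 1 0 * f 2 1 - f 1 1 * f 2 0"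
    unfolding det_2 Suc by (simp_all add: Suc del: One_nat_def)
  have sum3: "(\<Sum>j<Suc 2. g j) = g 0 + g 1 + g 2" for g :: "nat \<Rightarrow> 'a"
    by (simp add: numeral_2_eq_2)
  have sgn: "(-1) ^ 0 * x = x" "(-1) ^ 1 * x = - x" "(-1) ^ 2 * x = x" for x :: 'a
    by simp_all
  have 3: "(3 :: nat) = Suc 2" by simp
  show ?thesis
    unfolding 3 det_expand_first_row[of 2] sum3 mult.assoc sgn minors
    by (simp only: diff_conv_add_uminus)
qed

lemma det_4:
  fixes f :: "nat \<Rightarrow> nat \<Rightarrow> 'a :: comm_ring_1"
  shows "det (mat 4 4 (\<lambda>(i, j). f i j))
    = f 0 0 * (f 1 1 * (f 2 2 * f 3 3 - f 2 3 * f 3 2) - f 1 2 * (f 2 1 * f 3 3 - f 2 3 * f 3 1) + f 1 3 * (f 2 1 * f 3 2 - f 2 2 * f 3 1))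
    - f 0 1 * (f 1 0 * (f 2 2 * f 3 3 - f 2 3 * f 3 2) - f 1 2 * (f 2 0 * f 3 3 - f 2 3 * f 3 0) + f 1 3 * (f 2 0 * f 3 2 - f 2 2 * f 3 0))
    + f 0 2 * (f 1 0 * (f 2 1 * f 3 3 - f 2 3 * f 3 1) - f 1 1 * (f 2 0 * f 3 3 - f 2 3 * f 3 0) + f 1 3 * (f 2 0 * f 3 1 - f 2 1 * f 3 0))
    - f 0 3 * (f 1 0 * (f 2 1 * f 3 2 - f 2 2 * f 3 1) - f 1 1 * (f 2 0 * f 3 2 - f 2 2 * f 3 0) + f 1 2 * (f 2 0 * f 3 1 - f 2 1 * f 3 0))"
proof -
  have Suc: "Suc 0 = 1" "Suc 1 = 2" "Suc 2 = 3" by simp_all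
  have minors:
    "det (mat 3 3 (\<lambda>(i, c). f (Suc i) (if c < 0 then c else Suc c))) = f 1 1 * (f 2 2 * f 3 3 - f 2 3 * f 3 2) - f 1 2 * (f 2 1 * f 3 3 - f 2 3 * f 3 1) + f 1 3 * (f 2 1 * f 3 2 - f 2 2 * f 3 1)"
    "det (mat 3 3 (\<lambda>(i, c). f (Suc i) (if c < 1 then c else Suc c))) = f 1 0 * (f 2 2 * f 3 3 - f 2 3 * f 3 2) - f 1 2 * (f 2 0 * f 3 3 - f 2 3 * f 3 0) + f 1 3 * (f 2 0 * f 3 2 - f 2 2 * f 3 0)"
    "det (mat 3 3 (\<lambda>(i, c). f (Suc i) (if c < 2 then c else Suc c))) = f 1 0 * (f 2 1 * f 3 3 - f 2 3 * f 3 1) - f 1 1 * (f 2 0 * f 3 3 - f 2 3 * f 3 0) + f 1 3 * (f 2 0 * f 3 1 - f 2 1 * f 3 0)"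
    "det (mat 3 3 (\<lambda>(i, c). f (Suc i) (if c < 3 then c else Suc c))) = f 1 0 * (f 2 1 * f 3 2 - f 2 2 * f 3 1) - f 1 1 * (f 2 0 * f 3 2 - f 2 2 * f 3 0) + f 1 2 * (f 2 0 * f 3 1 - f 2 1 * f 3 0)"
    unfolding det_3 Suc by (simp_all add: Suc del: One_nat_def)
  have sum4: "(\<Sum>j<Suc 3. g j) = g 0 + g 1 + g 2 + g 3" for g :: "nat \<Rightarrow> 'a"
    by (simp add: numeral_2_eq_2 numeral_3_eq_3)
  have sgn: "(-1) ^ 0 * x = x" "(-1) ^ 1 * x = - x" "(-1) ^ 2 * x = x" "(-1) ^ 3 * x = - x" for x :: 'a
    by simp_all
  have 4: "(4 :: nat) = Suc 3" by simp
  show ?thesis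
    unfolding 4 det_expand_first_row[of 3] sum4 mult.assoc sgn minors
    by (simp only: diff_conv_add_uminus)
qed

lemmas small_det_simps = det_2 det_3 det_4 layer_entry_def layer_dist_def

text \<open>
  In each of the four determinants the first factor belongs to the antisymmetric and the second
  to the symmetric half.
\<close>

lemma layer_det_2:
  fixes s y :: "'a :: idom"
  shows "det (mat 4 4 (\<lambda>(i, j). layer_entry 2 s y i j))
    = (y^2 + 2 * y * s - s)
    * (y^2 - 4 * y * s - 2 * y - s)"
proof -
  have "det (mat 2 2 (\<lambda>(i, j). layer_entry 2 s y i j - layer_entry 2 s y (4 - 1 - i) j))
      = y^2 + 2 * y * s - s"
    unfolding small_det_simps by (simp, simp add: algebra_simps eval_nat_numeral)
  moreover have "det (mat 2 2 (\<lambda>(i, j). layer_entry 2 s y (2 + i) (2 + j)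
      + (if 2 \<le> 2 + j then layer_entry 2 s y (2 + i) (2 - 1 - j) else 0)))
      = y^2 - 4 * y * s - 2 * y - s"
    unfolding small_det_simps by (simp, simp add: algebra_simps eval_nat_numeral)
  moreover have "det (mat 4 4 (\<lambda>(i, j). layer_entry 2 s y i j))
    = det (mat 2 2 (\<lambda>(i, j). layer_entry 2 s y i j - layer_entry 2 s y (4 - 1 - i) j))
    * det (mat 2 2 (\<lambda>(i, j). layer_entry 2 s y (2 + i) (2 + j)
      + (if 2 \<le> 2 + j then layer_entry 2 s y (2 + i) (2 - 1 - j) else 0)))"
    by (rule centrosymmetric_det, rule layer_entry_symmetric) simp_all
  ultimately show ?thesis by (simp only:)
qed

lemma layer_det_3:
  fixes s y :: "'a :: idom"
  shows "det (mat 5 5 (\<lambda>(i, j). layer_entry 3 s y i j))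
    = (y^2 + 3 * y * s + y - s)
    * (y^3 - 5 * y^2 * s - 4 * y^2 - 4 * y * s + y + 3 * s)"
proof -
  have "det (mat 2 2 (\<lambda>(i, j). layer_entry 3 s y i j - layer_entry 3 s y (5 - 1 - i) j))
      = y^2 + 3 * y * s + y - s"
    unfolding small_det_simps by (simp, simp add: algebra_simps eval_nat_numeral)
  moreover have "det (mat 3 3 (\<lambda>(i, j). layer_entry 3 s y (2 + i) (2 + j)
      + (if 3 \<le> 2 + j then layer_entry 3 s y (2 + i) (3 - 1 - j) else 0)))
      = y^3 - 5 * y^2 * s - 4 * y^2 - 4 * y * s + y + 3 * s"
    unfolding small_det_simps by (simp, simp add: algebra_simps eval_nat_numeral)
  moreover have "det (mat 5 5 (\<lambda>(i, j). layer_entry 3 s y i j))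
    = det (mat 2 2 (\<lambda>(i, j). layer_entry 3 s y i j - layer_entry 3 s y (5 - 1 - i) j))
    * det (mat 3 3 (\<lambda>(i, j). layer_entry 3 s y (2 + i) (2 + j)
      + (if 3 \<le> 2 + j then layer_entry 3 s y (2 + i) (3 - 1 - j) else 0)))"
    by (rule centrosymmetric_det, rule layer_entry_symmetric) simp_all
  ultimately show ?thesis by (simp only:)
qed

lemma layer_det_4:
  fixes s y :: "'a :: idom"
  shows "det (mat 6 6 (\<lambda>(i, j). layer_entry 4 s y i j))
    = (y^3 + 4 * y^2 * s + 2 * y^2 - 2 * y * s - y)
    * (y^3 - 6 * y^2 * s - 6 * y^2 - 14 * y * s - y + 6 * s)"
proof -
  have "det (mat 3 3 (\<lambda>(i, j). layer_entry 4 s y i j - layer_entry 4 s y (6 - 1 - i) j))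
      = y^3 + 4 * y^2 * s + 2 * y^2 - 2 * y * s - y"
    unfolding small_det_simps by (simp, simp add: algebra_simps eval_nat_numeral)
  moreover have "det (mat 3 3 (\<lambda>(i, j). layer_entry 4 s y (3 + i) (3 + j)
      + (if 3 \<le> 3 + j then layer_entry 4 s y (3 + i) (3 - 1 - j) else 0)))
      = y^3 - 6 * y^2 * s - 6 * y^2 - 14 * y * s - y + 6 * s"
    unfolding small_det_simps by (simp, simp add: algebra_simps eval_nat_numeral)
  moreover have "det (mat 6 6 (\<lambda>(i, j). layer_entry 4 s y i j))
    = det (mat 3 3 (\<lambda>(i, j). layer_entry 4 s y i j - layer_entry 4 s y (6 - 1 - i) j))
    * det (mat 3 3 (\<lambda>(i, j). layer_entry 4 s y (3 + i) (3 + j)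
      + (if 3 \<le> 3 + j then layer_entry 4 s y (3 + i) (3 - 1 - j) else 0)))"
    by (rule centrosymmetric_det, rule layer_entry_symmetric) simp_all
  ultimately show ?thesis by (simp only:)
qed

lemma layer_det_5:
  fixes s y :: "'a :: idom"
  shows "det (mat 7 7 (\<lambda>(i, j). layer_entry 5 s y i j))
    = (y^3 + 5 * y^2 * s + 4 * y^2 - y - s)
    * (y^4 - 7 * y^3 * s - 9 * y^3 - 27 * y^2 * s - 3 * y^2 + 21 * y * s + 3 * y - 3 * s)"
proof -
  have "det (mat 3 3 (\<lambda>(i, j). layer_entry 5 s y i j - layer_entry 5 s y (7 - 1 - i) j))
      = y^3 + 5 * y^2 * s + 4 * y^2 - y - s"
    unfolding small_det_simps by (simp, simp add: algebra_simps eval_nat_numeral)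
  moreover have "det (mat 4 4 (\<lambda>(i, j). layer_entry 5 s y (3 + i) (3 + j)
      + (if 4 \<le> 3 + j then layer_entry 5 s y (3 + i) (4 - 1 - j) else 0)))
      = y^4 - 7 * y^3 * s - 9 * y^3 - 27 * y^2 * s - 3 * y^2 + 21 * y * s + 3 * y - 3 * s"
    unfolding small_det_simps by (simp, simp add: algebra_simps eval_nat_numeral)
  moreover have "det (mat 7 7 (\<lambda>(i, j). layer_entry 5 s y i j))
    = det (mat 3 3 (\<lambda>(i, j). layer_entry 5 s y i j - layer_entry 5 s y (7 - 1 - i) j))
    * det (mat 4 4 (\<lambda>(i, j). layer_entry 5 s y (3 + i) (3 + j)
      + (if 4 \<le> 3 + j then layer_entry 5 s y (3 + i) (4 - 1 - j) else 0)))"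
    by (rule centrosymmetric_det, rule layer_entry_symmetric) simp_all
  ultimately show ?thesis by (simp only:)
qed

section \<open>Distances and characteristic polynomial of a layered graph\<close>

text \<open>
  The path vertex with index \<open>i\<close> forms the layer \<open>i + 1\<close>, the free vertices of the two cliques
  form the layers 0 and \<open>l + 1\<close>. Beyond the sizes of the layers, this description of adjacency
  is all that the rest of the proof uses about barbell graphs.
\<close>

lemma barbell_layers:
  assumes "barbell_graph t l G"
  obtains lay :: "'a \<Rightarrow> nat"
  where "\<And>v. v \<in> verts G \<Longrightarrow> lay v \<le> l + 1"
    and "\<And>u v. u \<in> verts G \<Longrightarrow> v \<in> verts G \<Longrightarrow>
      (u, v) \<in> arcs_ends G \<longleftrightarrow> u \<noteq> v \<and> lay u \<le> lay v + 1 \<and> lay v \<le> lay u + 1"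
    and "\<And>j. j \<le> l + 1 \<Longrightarrow> card {v \<in> verts G. lay v = j} = (if j = 0 \<or> j = l + 1 then t - 1 else 1)"
    and "1 \<le> t" and "2 \<le> l"
proof -
  from assms obtain A B p where G: "graph G" and cA: "card A = t" and cB: "card B = t" and AB: "A \<inter> B = {}"
    and p: "p \<noteq> []" "distinct p" and len: "length p = l"
    and Ap: "A \<inter> set p = {hd p}" and Bp: "B \<inter> set p = {last p}"
    and V: "verts G = A \<union> B \<union> set p"
    and E: "arcs_ends G = clique_ends A \<union> clique_ends B \<union> path_ends p"
    unfolding barbell_graph_def by blast
  interpret graph G by fact
  have fin: "finite A" "finite B" using finite_verts V by auto
  have l0: "0 < l" using p(1) len by auto
  have ends: "hd p = p ! 0" "last p = p ! (l - 1)" using p(1) len by (simp_all add: hd_conv_nth last_conv_nth)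
  have inA: "p ! i \<in> A \<longleftrightarrow> i = 0" if "i < l" for i
  proof -
    have "p ! i \<in> A \<longleftrightarrow> p ! i = hd p" using Ap that len by (metis Int_iff insertCI nth_mem singletonD)
    then show ?thesis using that len p(2) l0 by (simp add: ends nth_eq_iff_index_eq)
  qed
  have inB: "p ! i \<in> B \<longleftrightarrow> i = l - 1" if "i < l" for i
  proof -
    have "p ! i \<in> B \<longleftrightarrow> p ! i = last p" using Bp that len by (metis Int_iff insertCI nth_mem singletonD)
    then show ?thesis using that len p(2) l0 by (simp add: ends nth_eq_iff_index_eq)
  qed
  have l2: "2 \<le> l" using inA[of 0] inB[of 0] l0 AB by (cases "l = 1") auto
  have "hd p \<in> A" using Ap by auto
  then have t1: "1 \<le> t" using cA fin by (metis One_nat_def Suc_leI card_gt_0_iff empty_iff)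
  define lay where "lay v = (if v \<in> set p then Suc (THE i. i < l \<and> p ! i = v) else if v \<in> A then 0 else l + 1)" for v
  have layp: "lay (p ! i) = Suc i" if "i < l" for i
  proof -
    have "(THE j. j < l \<and> p ! j = p ! i) = i"
      using that len p(2) by (intro the_equality) (auto simp: nth_eq_iff_index_eq)
    then show ?thesis using that len by (simp add: lay_def)
  qed
  have layA: "lay v = 0" if "v \<in> A" "v \<notin> set p" for v using that by (simp add: lay_def)
  have layB: "lay v = l + 1" if "v \<in> B" "v \<notin> set p" for v using that AB by (auto simp: lay_def)
  have cases: thesis' if "v \<in> verts G" "\<And>i. i < l \<Longrightarrow> v = p ! i \<Longrightarrow> thesis'"
    "v \<in> A \<Longrightarrow> v \<notin> set p \<Longrightarrow> v \<notin> B \<Longrightarrow> thesis'" "v \<in> B \<Longrightarrow> v \<notin> set p \<Longrightarrow> v \<notin> A \<Longrightarrow> thesis'" for v thesis'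
    using that V AB len by (metis UnE disjoint_iff in_set_conv_nth)
  have path: "(p ! i, p ! j) \<in> path_ends p \<longleftrightarrow> j = Suc i \<or> i = Suc j" if "i < l" "j < l" for i j
    using that p(2) len by (auto simp: path_ends_def nth_eq_iff_index_eq)
  have nopath: "(u, v) \<notin> path_ends p" if "u \<notin> set p \<or> v \<notin> set p" for u v
    using that by (auto simp: path_ends_def)
  have arcs: "(u, v) \<in> arcs_ends G \<longleftrightarrow> u \<noteq> v \<and> lay u \<le> lay v + 1 \<and> lay v \<le> lay u + 1"
    if u: "u \<in> verts G" and v: "v \<in> verts G" for u v
  proof (rule cases[OF u])
    fix i assume i: "i < l" "u = p ! i"
    show ?thesis
    proof (rule cases[OF v])
      fix j assume j: "j < l" "v = p ! j"
      show ?thesis using i j p(2) len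
        by (auto simp: E clique_ends_def path layp inA inB nth_eq_iff_index_eq)
    next
      assume v: "v \<in> A" "v \<notin> set p" "v \<notin> B"
      then show ?thesis using i len by (auto simp: E clique_ends_def nopath layp layA inA)
    next
      assume v: "v \<in> B" "v \<notin> set p" "v \<notin> A"
      then show ?thesis using i len by (auto simp: E clique_ends_def nopath layp layB inB)
    qed
  next
    assume u: "u \<in> A" "u \<notin> set p" "u \<notin> B"
    show ?thesis
    proof (rule cases[OF v])
      fix j assume j: "j < l" "v = p ! j"
      then show ?thesis using u len by (auto simp: E clique_ends_def nopath layp layA inA)
    next
      assume v: "v \<in> A" "v \<notin> set p" "v \<notin> B"
      then show ?thesis using u by (auto simp: E clique_ends_def nopath layA)
    next
      assume v: "v \<in> B" "v \<notin> set p" "v \<notin> A"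
      then show ?thesis using u l2 by (auto simp: E clique_ends_def nopath layA layB)
    qed
  next
    assume u: "u \<in> B" "u \<notin> set p" "u \<notin> A"
    show ?thesis
    proof (rule cases[OF v])
      fix j assume j: "j < l" "v = p ! j"
      then show ?thesis using u len by (auto simp: E clique_ends_def nopath layp layB inB)
    next
      assume v: "v \<in> A" "v \<notin> set p" "v \<notin> B"
      then show ?thesis using u l2 by (auto simp: E clique_ends_def nopath layA layB)
    next
      assume v: "v \<in> B" "v \<notin> set p" "v \<notin> A"
      then show ?thesis using u by (auto simp: E clique_ends_def nopath layB)
    qed
  qed
  have le: "lay v \<le> l + 1" if "v \<in> verts G" for v
    by (rule cases[OF that]) (simp_all add: layp layA layB)
  have card: "card {v \<in> verts G. lay v = j} = (if j = 0 \<or> j = l + 1 then t - 1 else 1)" if j: "j \<le> l + 1" for j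
  proof -
    consider "j = 0" | "j = l + 1" | "1 \<le> j" "j \<le> l" using j by linarith
    then show ?thesis
    proof cases
      case 1
      have "v \<in> A - {hd p}" if "v \<in> verts G" "lay v = 0" for v
        by (rule cases[OF that(1)]) (use that Ap \<open>hd p \<in> A\<close> in \<open>auto simp: layp layB\<close>)
      moreover have "v \<in> verts G" "lay v = 0" if "v \<in> A - {hd p}" for v
        using that Ap V layA by blast+
      ultimately have "{v \<in> verts G. lay v = j} = A - {hd p}" unfolding 1 by blast
      then show ?thesis using 1 cA fin \<open>hd p \<in> A\<close> by (simp add: card_Diff_singleton)
    next
      case 2
      have "last p \<in> B" using Bp by auto
      have "v \<in> B - {last p}" if "v \<in> verts G" "lay v = l + 1" for v
        by (rule cases[OF that(1)]) (use that Bp in \<open>auto simp: layp layA\<close>)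
      moreover have "v \<in> verts G" "lay v = l + 1" if "v \<in> B - {last p}" for v
        using that Bp V layB by blast+
      ultimately have "{v \<in> verts G. lay v = j} = B - {last p}" unfolding 2 by blast
      then show ?thesis using 2 cB fin \<open>last p \<in> B\<close> by (simp add: card_Diff_singleton)
    next
      case 3
      have "v = p ! (j - 1)" if "v \<in> verts G" "lay v = j" for v
        by (rule cases[OF that(1)]) (use that 3 in \<open>auto simp: layp layA layB\<close>)
      moreover have "p ! (j - 1) \<in> verts G" "lay (p ! (j - 1)) = j"
        using 3 len V layp[of "j - 1"] by auto
      ultimately have "{v \<in> verts G. lay v = j} = {p ! (j - 1)}" by blast
      then show ?thesis using 3 by simp
    qed
  qed
  show thesis using that[OF le arcs card t1 l2] by blast
qed

text \<open>
  An arc changes the layer by at most one, which bounds walks from below. Conversely a walk can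
  move by one layer towards its target at each step, because any two vertices of neighbouring
  layers are adjacent. Two distinct vertices of the same layer are adjacent as well.
\<close>

lemma layered_distance:
  fixes lay :: "'a \<Rightarrow> nat"
  assumes "wf_digraph G"
    and adj: "\<And>u v. u \<in> verts G \<Longrightarrow> v \<in> verts G \<Longrightarrow>
      (u, v) \<in> arcs_ends G \<longleftrightarrow> u \<noteq> v \<and> lay u \<le> lay v + 1 \<and> lay v \<le> lay u + 1"
    and inhabited: "\<And>u v j. u \<in> verts G \<Longrightarrow> v \<in> verts G \<Longrightarrow> lay u < j \<Longrightarrow> j < lay v \<Longrightarrow> \<exists>w\<in>verts G. lay w = j"
    and uv: "u \<in> verts G" "v \<in> verts G"
  shows "graph_dist G u v = layer_dist (lay u) (lay v) + (if lay u = lay v \<and> u \<noteq> v then 1 else 0)"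
proof -
  interpret wf_digraph G by fact
  have cost: "awalk_cost (\<lambda>_. 1) q = real (length q)" for q
    by (simp add: awalk_cost_def sum_list_triv)
  have lower: "lay x \<le> lay v + length q \<and> lay v \<le> lay x + length q" if "awalk x q v" for x q
    using that
  proof (induction q arbitrary: x)
    case Nil
    then show ?case by (simp add: awalk_Nil_iff)
  next
    case (Cons e q)
    then have e: "e \<in> arcs G" "x = tail G e" "awalk (head G e) q v" by (auto simp: awalk_Cons_iff)
    then have "(x, head G e) \<in> arcs_ends G" by (auto simp: arcs_ends_conv)
    then have "lay x \<le> lay (head G e) + 1 \<and> lay (head G e) \<le> lay x + 1"
      using adj adj_in_verts by blast
    then show ?case using Cons.IH[OF e(3)] by auto
  qed
  have step: "\<exists>q'. awalk x q' v \<and> length q' = Suc (length q)"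
    if arc: "(x, y) \<in> arcs_ends G" and q: "awalk y q v" for x y q
  proof -
    obtain e where "e \<in> arcs G" "tail G e = x" "head G e = y" using arc by (auto simp: arcs_ends_conv)
    then have "awalk x (e # q) v" using q by (auto simp: awalk_Cons_iff)
    then show ?thesis by (intro exI[of _ "e # q"]) simp
  qed
  have upper: "\<exists>q. awalk x q v \<and> length q = d"
    if "x \<in> verts G" "(lay x - lay v) + (lay v - lay x) = d" "d \<noteq> 0" for x d
    using that
  proof (induction d arbitrary: x)
    case (Suc d)
    show ?case
    proof (cases "d = 0")
      case True
      then have "(x, v) \<in> arcs_ends G" using Suc.prems uv(2) by (subst adj) auto
      then show ?thesis using step[of x v "[]"] uv(2) True by (simp add: awalk_Nil_iff)
    next
      case False
      obtain y where y: "y \<in> verts G" "lay y = (if lay x < lay v then lay x + 1 else lay x - 1)"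
      proof (cases "lay x < lay v")
        case True
        then have "lay x < lay x + 1" "lay x + 1 < lay v" using Suc.prems(2) False by linarith+
        then show ?thesis using inhabited[OF Suc.prems(1) uv(2)] that True by (metis (full_types))
      next
        case gt: False
        then have "lay v < lay x - 1" "lay x - 1 < lay x" using Suc.prems(2) False by linarith+
        then show ?thesis using inhabited[OF uv(2) Suc.prems(1)] that gt by (metis (full_types))
      qed
      have d: "(lay y - lay v) + (lay v - lay y) = d" using y(2) Suc.prems(2) False by (auto split: if_splits)
      have "(x, y) \<in> arcs_ends G" using Suc.prems y by (subst adj) (auto split: if_splits)
      then show ?thesis using Suc.IH[OF y(1) d False] step[of x y] by auto
    qed
  qed simp
  define d where "d = (lay u - lay v) + (lay v - lay u) + (if lay u = lay v \<and> u \<noteq> v then 1 else 0)"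
  have "\<exists>q. awalk u q v \<and> length q = d"
  proof (cases "lay u = lay v")
    case True
    show ?thesis
    proof (cases "u = v")
      case eq: True
      then show ?thesis using uv by (intro exI[of _ "[]"]) (simp add: d_def awalk_Nil_iff)
    next
      case neq: False
      then have "(u, v) \<in> arcs_ends G" using True uv by (subst adj) auto
      then show ?thesis using step[of u v "[]"] uv True neq by (simp add: d_def awalk_Nil_iff)
    qed
  next
    case False
    then show ?thesis using upper[OF uv(1), of d] by (simp add: d_def)
  qed
  then obtain q where q: "awalk u q v" "length q = d" by blast
  have "\<mu> (\<lambda>_. 1) u v \<le> ereal (real d)"
    using min_cost_le_walk_cost[OF q(1), of "\<lambda>_. 1"] q(2) by (simp add: cost)
  moreover have "ereal (real d) \<le> \<mu> (\<lambda>_. 1) u v"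
    unfolding \<mu>_def
  proof (rule INF_greatest)
    fix r assume "r \<in> {r. awalk u r v}"
    then have r: "awalk u r v" by simp
    have "u \<noteq> v \<Longrightarrow> r \<noteq> []" using r by (auto simp: awalk_Nil_iff)
    then have "d \<le> length r" using lower[OF r] by (cases r) (auto simp: d_def)
    then show "ereal (real d) \<le> ereal (awalk_cost (\<lambda>_. 1) r)" by (simp add: cost)
  qed
  ultimately have "\<mu> (\<lambda>_. 1) u v = ereal (real d)" by (rule antisym)
  then show ?thesis by (simp add: graph_dist_def layer_dist_def d_def)
qed

lemma layered_char_poly:
  fixes lay :: "'a \<Rightarrow> nat" and vs :: "'a list"
  assumes vs: "distinct vs"
    and dist: "\<And>u v. u \<in> set vs \<Longrightarrow> v \<in> set vs \<Longrightarrow>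
      graph_dist G u v = layer_dist (lay u) (lay v) + (if lay u = lay v \<and> u \<noteq> v then 1 else 0)"
    and le: "\<And>v. v \<in> set vs \<Longrightarrow> lay v \<le> l + 1"
    and card: "\<And>j. j \<le> l + 1 \<Longrightarrow> card {v \<in> set vs. lay v = j} = (if j = 0 \<or> j = l + 1 then s else 1)"
  shows "(x + 1) ^ (l + 2) * poly (char_poly (distance_matrix G vs)) x
    = (x + 1) ^ length vs * det (mat (l + 2) (l + 2) (\<lambda>(i, j). layer_entry l (real s) (x + 1) i j))"
proof -
  let ?n = "length vs" and ?D = "distance_matrix G vs"
  define w :: "nat \<Rightarrow> nat \<Rightarrow> real" where "w a b = layer_dist a b + (if a = b then 1 else 0)" for a b
  have D: "?D \<in> carrier_mat ?n ?n" by (simp add: distance_matrix_def)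
  have "- char_matrix ?D x = mat ?n ?n (\<lambda>(i, j). (if i = j then x + 1 else 0) - w (lay (vs ! i)) (lay (vs ! j)))"
    using vs by (intro eq_matI)
      (auto simp: char_matrix_def distance_matrix_def dist w_def nth_eq_iff_index_eq layer_dist_def)
  then have chi: "poly (char_poly ?D) x
      = det (mat ?n ?n (\<lambda>(i, j). (if i = j then x + 1 else 0) - w (lay (vs ! i)) (lay (vs ! j))))"
    using char_poly_matrix[OF D] by simp
  have count: "card {i. i < ?n \<and> lay (vs ! i) = b} = (if b = 0 \<or> b = l + 1 then s else 1)" if "b \<le> l + 1" for b
  proof -
    have "bij_betw (\<lambda>i. vs ! i) {i. i < ?n \<and> lay (vs ! i) = b} {v \<in> set vs. lay v = b}"
      using vs by (auto simp: bij_betw_def inj_on_def nth_eq_iff_index_eq in_set_conv_nth)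
    then show ?thesis unfolding card[OF that, symmetric] by (rule bij_betw_same_card)
  qed
  have "mat (l + 2) (l + 2) (\<lambda>(a, b). (if a = b then x + 1 else 0) - w a b * of_nat (card {i. i < ?n \<and> lay (vs ! i) = b}))
      = mat (l + 2) (l + 2) (\<lambda>(i, j). layer_entry l (real s) (x + 1) i j)"
    by (intro eq_matI) (auto simp: layer_entry_def w_def count)
  moreover have "lay (vs ! i) < l + 2" if "i < ?n" for i
    using le[of "vs ! i"] that by simp
  ultimately show ?thesis
    using quotient_det[of ?n "\<lambda>i. lay (vs ! i)" "l + 2" "x + 1" w] unfolding chi by simp
qed

lemma det_minus_x_eq:
  assumes "D \<in> carrier_mat n n"
  shows "det_minus_x D = (-1) ^ n * char_poly D"
proof -
  have "map_mat (\<lambda>a. [:a:]) D - [:0, 1:] \<cdot>\<^sub>m 1\<^sub>m (dim_row D) = (-1) \<cdot>\<^sub>m char_poly_matrix D"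
    using assms by (intro eq_matI) (auto simp: char_poly_matrix_def)
  then show ?thesis using assms by (simp add: det_minus_x_def char_poly_def char_poly_matrix_def)
qed

section \<open>Unimodality and central binomial coefficients\<close>

text \<open>
  Log-concavity says that the ratios of successive terms decrease, so a ratio at most 1 is
  inherited to the right and a ratio at least 1 to the left.
\<close>

lemma log_concave_unimodal:
  fixes a :: "nat \<Rightarrow> real"
  assumes pos: "\<And>i. i \<le> N \<Longrightarrow> 0 < a i"
    and lc: "\<And>i. i + 2 \<le> N \<Longrightarrow> a i * a (i + 2) \<le> (a (i + 1))\<^sup>2"
    and m: "m \<le> N" and left: "1 \<le> m \<Longrightarrow> a (m - 1) \<le> a m" and right: "m < N \<Longrightarrow> a (m + 1) \<le> a m"
  shows "unimodal_with_peak a N m"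
proof -
  have down: "a (i + 2) \<le> a (i + 1)" if "a (i + 1) \<le> a i" "i + 2 \<le> N" for i
  proof -
    have "a (i + 1) * a (i + 2) \<le> a i * a (i + 2)"
      using that pos by (intro mult_right_mono) (auto simp: less_imp_le)
    then have "a (i + 1) * a (i + 2) \<le> a (i + 1) * a (i + 1)"
      using lc[OF that(2)] by (simp add: power2_eq_square)
    then show ?thesis using pos[of "i + 1"] that(2) by simp
  qed
  have desc: "a (i + 1) \<le> a i" if "m \<le> i" "i < N" for i
    using that
  proof (induction i rule: dec_induct)
    case base
    then show ?case using right by simp
  next
    case (step i)
    then show ?case using down[of i] by simp
  qed
  have up: "a i \<le> a (i + 1)" if "a (i + 1) \<le> a (i + 2)" "i + 2 \<le> N" for i
  proof -
    have "a i * a (i + 1) \<le> a i * a (i + 2)"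
      using that pos by (intro mult_left_mono) (auto simp: less_imp_le)
    then have "a (i + 1) * a i \<le> a (i + 1) * a (i + 1)"
      using lc[OF that(2)] by (simp add: power2_eq_square mult.commute)
    then show ?thesis using pos[of "i + 1"] that(2) by simp
  qed
  have asc: "a (m - 1 - i) \<le> a (m - i)" if "i < m" for i
    using that
  proof (induction i)
    case 0
    then show ?case using left by simp
  next
    case (Suc i)
    then have "m - 1 - i = (m - 1 - Suc i) + 1" "m - i = (m - 1 - Suc i) + 2" "m - Suc i = (m - 1 - Suc i) + 1" by simp_all
    then show ?case using up[of "m - 1 - Suc i"] Suc m by simp
  qed
  have "a (i - 1) \<le> a i" if "1 \<le> i" "i \<le> m" for i
    using asc[of "m - i"] that by simp
  then show ?thesis using m desc by (simp add: unimodal_with_peak_def)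
qed

text \<open>
  At \<open>u = m\<close> this is \<open>2 m choose (m + k)\<close> divided by \<open>(2 m)! / (m! (m + K)!)\<close>: the quotient of
  \<open>m!\<close> and \<open>(m - k)!\<close> times the quotient of \<open>(m + K)!\<close> and \<open>(m + k)!\<close>. As a product it is
  polynomial in \<open>u\<close>, and it vanishes for \<open>k > m\<close> just as the binomial coefficient does.
\<close>

definition central_weight :: "nat \<Rightarrow> real \<Rightarrow> nat \<Rightarrow> real" where
  "central_weight K u k = (\<Prod>i<k. u - real i) * (\<Prod>i\<in>{k<..K}. u + real i)"

lemma central_binomial_ratio:
  "\<exists>w\<ge>0. \<forall>k\<le>K. real (2 * m choose (m + k)) = w * central_weight K (real m) k"
proof (induction K)
  case 0
  show ?case by (rule exI[of _ "real (2 * m choose m)"]) (simp add: central_weight_def)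
next
  case (Suc K)
  then obtain w where w: "w \<ge> 0" "\<And>k. k \<le> K \<Longrightarrow> real (2 * m choose (m + k)) = w * central_weight K (real m) k"
    by blast
  let ?w = "w / (real m + real (Suc K))"
  have ivl: "{k<..Suc K} = insert (Suc K) {k<..K}" if "k \<le> K" for k using that by auto
  have "real (2 * m choose (m + k)) = ?w * central_weight (Suc K) (real m) k" if "k \<le> Suc K" for k
  proof (cases "k = Suc K")
    case False
    then have "k \<le> K" using that by simp
    then show ?thesis using w(2)[of k] by (simp add: central_weight_def ivl field_simps)
  next
    case True
    have step: "real (m + Suc K) * real (2 * m choose (m + Suc K)) = (real m - real K) * real (2 * m choose (m + K))"
    proof (cases "K \<le> m")
      case le: True
      have "(m + Suc K) * (2 * m choose (m + Suc K)) = (2 * m - (m + K)) * (2 * m choose (m + K))"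
        using binomial_absorb_comp[of "2 * m" "m + K"] binomial_absorption[of "m + K" "2 * m"]
        by (metis add_Suc_right)
      then have "real (m + Suc K) * real (2 * m choose (m + Suc K)) = real (2 * m - (m + K)) * real (2 * m choose (m + K))"
        by (metis of_nat_mult)
      moreover have "real (2 * m - (m + K)) = real m - real K" using le by (simp add: of_nat_diff)
      ultimately show ?thesis by simp
    next
      case gt: False
      then show ?thesis by (simp add: binomial_eq_0)
    qed
    have "real (2 * m choose (m + Suc K)) = (real m - real K) * (w * central_weight K (real m) K) / real (m + Suc K)"
      using step w(2)[of K] by (simp add: field_simps)
    then show ?thesis using True by (simp add: central_weight_def ac_simps)
  qed
  then show ?case using w(1) by (intro exI[of _ ?w]) simp
qed

lemma coeff_binomial_power: "coeff ([:1, 1:] ^ n :: real poly) i = real (n choose i)"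
proof (cases "i \<le> n")
  case False
  then have "degree ([:1, 1:] ^ n :: real poly) < i" by (simp add: degree_linear_power)
  then show ?thesis using False by (simp add: coeff_eq_0 binomial_eq_0)
qed (simp add: coeff_linear_poly_power)

text \<open>
  The coefficients of \<open>(1 + x) ^ (2 m)\<close> within distance \<open>K\<close> of the middle one, shifted up by \<open>K\<close>.
  The shift keeps all indices natural numbers of the form \<open>m + e\<close>, even for small \<open>m\<close>.
\<close>

lemma central_window:
  obtains w and R :: "real poly" where "w \<ge> 0"
    and "\<And>f i. coeff (f * [:1, 1:] ^ (2 * m)) i = coeff (f * R) (i + K)"
    and "\<And>e. e \<le> 2 * K \<Longrightarrow>
      coeff R (m + e) = w * central_weight K (real m) (if e \<le> K then K - e else e - K)"
proof -
  obtain w where w: "w \<ge> 0" "\<And>k. k \<le> K \<Longrightarrow> real (2 * m choose (m + k)) = w * central_weight K (real m) k"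
    using central_binomial_ratio by blast
  define R :: "real poly" where "R = monom 1 K * [:1, 1:] ^ (2 * m)"
  have "coeff (f * [:1, 1:] ^ (2 * m)) i = coeff (f * R) (i + K)" for f i
  proof -
    have "f * R = monom 1 K * (f * [:1, 1:] ^ (2 * m))" unfolding R_def by (rule mult.left_commute)
    then show ?thesis by (simp only: coeff_monom_mult) simp
  qed
  moreover have "coeff R (m + e) = w * central_weight K (real m) (if e \<le> K then K - e else e - K)"
    if "e \<le> 2 * K" for e
  proof (cases "e \<le> K")
    case False
    then have "w * central_weight K (real m) (e - K) = real (2 * m choose (m + (e - K)))"
      using w(2)[of "e - K"] that by simp
    moreover have "coeff R (m + e) = real (2 * m choose (m + (e - K)))"
      using False unfolding R_def coeff_monom_mult by (simp add: coeff_binomial_power)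
    ultimately show ?thesis using False by simp
  next
    case le: True
    have "coeff R (m + e) = real (2 * m choose (m + (K - e)))"
    proof (cases "K \<le> m + e")
      case True
      have "2 * m choose (m + e - K) = 2 * m choose (m + (K - e))"
        using le True binomial_symmetric[of "m + e - K" "2 * m"] by (simp add: mult_2)
      then show ?thesis using le True unfolding R_def coeff_monom_mult by (simp add: coeff_binomial_power)
    next
      case False
      then show ?thesis unfolding R_def coeff_monom_mult by (simp add: binomial_eq_0)
    qed
    then show ?thesis using w(2)[of "K - e"] le by simp
  qed
  ultimately show ?thesis using that w(1) by blast
qed

section \<open>The coefficients around and below the peak\<close>

text \<open>
  With \<open>u = t - 2\<close>, the sum of \<open>low_part\<close> and a binomial is the nontrivial factor of
  \<open>- det (x I - D)\<close>. Splitting it in this way isolates the only negative coefficient, the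
  leading one, together with the coefficient that makes up for it. The last case stands for
  \<open>l = 5\<close>.
\<close>

definition low_part :: "nat \<Rightarrow> real \<Rightarrow> real poly" where
  "low_part l u = (if l = 2 then [:5 * u^2 + 16 * u + 12, 14 * u^2 + 44 * u + 32, 8 * u^2 + 28 * u + 20:]
     else if l = 3 then [:12 * u^2 + 40 * u + 32, 46 * u^2 + 152 * u + 120, 52 * u^2 + 176 * u + 140, 15 * u^2 + 60 * u + 50:]
     else if l = 4 then [:28 * u^2 + 96 * u + 80, 136 * u^2 + 464 * u + 384, 224 * u^2 + 776 * u + 648, 140 * u^2 + 516 * u + 448, 24 * u^2 + 110 * u + 105:]
     else [:64 * u^2 + 224 * u + 192, 376 * u^2 + 1312 * u + 1120, 812 * u^2 + 2864 * u + 2464, 778 * u^2 + 2848 * u + 2520, 310 * u^2 + 1246 * u + 1176, 35 * u^2 + 182 * u + 196:])"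

definition barbell_factor :: "nat \<Rightarrow> real \<Rightarrow> real poly" where
  "barbell_factor l u = low_part l u + monom 1 (l + 1) * [:2 * u, -1:]"

lemma barbell_factor_coeffs:
  "barbell_factor 2 u = [:5 * u^2 + 16 * u + 12, 14 * u^2 + 44 * u + 32, 8 * u^2 + 28 * u + 20, 2 * u, -1:]"
  "barbell_factor 3 u = [:12 * u^2 + 40 * u + 32, 46 * u^2 + 152 * u + 120, 52 * u^2 + 176 * u + 140, 15 * u^2 + 60 * u + 50, 2 * u, -1:]"
  "barbell_factor 4 u = [:28 * u^2 + 96 * u + 80, 136 * u^2 + 464 * u + 384, 224 * u^2 + 776 * u + 648, 140 * u^2 + 516 * u + 448, 24 * u^2 + 110 * u + 105, 2 * u, -1:]"
  "barbell_factor 5 u = [:64 * u^2 + 224 * u + 192, 376 * u^2 + 1312 * u + 1120, 812 * u^2 + 2864 * u + 2464, 778 * u^2 + 2848 * u + 2520, 310 * u^2 + 1246 * u + 1176, 35 * u^2 + 182 * u + 196, 2 * u, -1:]"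
  by (simp_all add: barbell_factor_def low_part_def monom_altdef eval_nat_numeral)

lemma layer_det_eq_barbell_factor:
  assumes "l \<in> {2, 3, 4, 5}"
  shows "det (mat (l + 2) (l + 2) (\<lambda>(i, j). layer_entry l (u + 1) (x + 1) i j)) = - poly (barbell_factor l u) x"
proof -
  consider "l = 2" | "l = 3" | "l = 4" | "l = 5" using assms by auto
  then show ?thesis
  proof cases
    case 1
    show ?thesis unfolding 1 by (simp add: layer_det_2 barbell_factor_def low_part_def poly_monom) (simp add: algebra_simps eval_nat_numeral)
  next
    case 2
    show ?thesis unfolding 2 by (simp add: layer_det_3 barbell_factor_def low_part_def poly_monom) (simp add: algebra_simps eval_nat_numeral)
  next
    case 3
    show ?thesis unfolding 3 by (simp add: layer_det_4 barbell_factor_def low_part_def poly_monom) (simp add: algebra_simps eval_nat_numeral)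
  next
    case 4
    show ?thesis unfolding 4 by (simp add: layer_det_5 barbell_factor_def low_part_def poly_monom) (simp add: algebra_simps eval_nat_numeral)
  qed
qed

lemma pos_coeffs_mult_binomial_power:
  fixes r :: "real poly"
  assumes "\<And>i. 0 \<le> coeff r i" and "\<And>i. i \<le> d \<Longrightarrow> 0 < coeff r i"
  shows "0 \<le> coeff (r * [:1, 1:] ^ N) i \<and> (i \<le> d + N \<longrightarrow> 0 < coeff (r * [:1, 1:] ^ N) i)"
proof (induction N arbitrary: i)
  case 0
  then show ?case using assms by simp
next
  case (Suc N)
  have "r * [:1, 1:] ^ Suc N = r * [:1, 1:] ^ N + pCons 0 (r * [:1, 1:] ^ N)" by (simp add: distrib_left mult.left_commute)
  then have "coeff (r * [:1, 1:] ^ Suc N) i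
      = coeff (r * [:1, 1:] ^ N) i + (case i of 0 \<Rightarrow> 0 | Suc j \<Rightarrow> coeff (r * [:1, 1:] ^ N) j)"
    by (simp add: coeff_pCons split: nat.split)
  then show ?case
    using Suc.IH[of i] Suc.IH[of "i - 1"] by (cases i) (auto simp: add_nonneg_nonneg add_nonneg_pos)
qed

text \<open>
  The coefficient is \<open>M (M choose j) - (M choose (j - 1))\<close>, and the quotient of these two binomial
  coefficients is \<open>(M - j + 1) / j\<close>, which is at least \<open>1 / M\<close>.
\<close>

lemma top_part_nonneg:
  assumes "j < M"
  shows "0 \<le> coeff ([:real M, -1:] * [:1, 1:] ^ M) j"
proof (cases j)
  case 0
  then show ?thesis by (simp add: coeff_binomial_power)
next
  case (Suc i)
  have "real (Suc i) * real (M choose Suc i) = real (M - i) * real (M choose i)"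
    using binomial_absorb_comp[of M i] binomial_absorption[of i M] by (metis of_nat_mult)
  moreover have "real (M choose i) \<le> real (M - i) * real (M choose i)"
    using assms Suc by (simp add: mult_le_cancel_right1)
  moreover have "real (Suc i) * real (M choose Suc i) \<le> real M * real (M choose Suc i)"
    using assms Suc by (intro mult_right_mono) auto
  ultimately show ?thesis using Suc by (simp add: coeff_binomial_power)
qed

lemma low_part_pos:
  assumes "l \<in> {2, 3, 4, 5}" and "u \<ge> 0"
  shows "0 \<le> coeff (low_part l u) i" and "i \<le> l \<Longrightarrow> 0 < coeff (low_part l u) i"
proof -
  have "0 \<le> coeff (low_part l u) i \<and> (i \<le> l \<longrightarrow> 0 < coeff (low_part l u) i)"
    using assms by (auto simp: low_part_def coeff_pCons eval_nat_numeral split: nat.split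
      intro!: add_nonneg_pos add_nonneg_nonneg mult_nonneg_nonneg)
  then show "0 \<le> coeff (low_part l u) i" and "i \<le> l \<Longrightarrow> 0 < coeff (low_part l u) i" by auto
qed

lemma barbell_factor_coeffs_pos:
  assumes "l \<in> {2, 3, 4, 5}" and "i \<le> l + 2 * m"
  shows "0 < coeff (barbell_factor l (real m) * [:1, 1:] ^ (2 * m)) i"
proof -
  have "0 < coeff (low_part l (real m) * [:1, 1:] ^ (2 * m)) i"
    using pos_coeffs_mult_binomial_power[of "low_part l (real m)" l "2 * m" i] low_part_pos[of l "real m"] assms
    by simp
  moreover have "0 \<le> coeff (monom 1 (l + 1) * ([:real (2 * m), -1:] * [:1, 1:] ^ (2 * m))) i"
  proof (cases "l + 1 \<le> i")
    case True
    then have "0 \<le> coeff ([:real (2 * m), -1:] * [:1, 1:] ^ (2 * m)) (i - (l + 1))"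
      using assms(2) by (intro top_part_nonneg) auto
    then show ?thesis using True unfolding coeff_monom_mult by simp
  next
    case False
    then show ?thesis unfolding coeff_monom_mult by simp
  qed
  moreover have "barbell_factor l (real m) * [:1, 1:] ^ (2 * m) = low_part l (real m) * [:1, 1:] ^ (2 * m)
      + monom 1 (l + 1) * ([:real (2 * m), -1:] * [:1, 1:] ^ (2 * m))"
    by (simp only: barbell_factor_def distrib_right mult.assoc of_nat_mult of_nat_numeral)
  ultimately show ?thesis by (simp del: mult_pCons_left mult_pCons_right)
qed

text \<open>
  The four comparisons of the peak with its neighbours follow one pattern. A coefficient at a
  distance of at most 2 or 3 from \<open>m\<close> involves binomial coefficients at most \<open>K\<close> away from
  the middle, with \<open>K\<close> at most 6. After the common factor \<open>w\<close> is taken out, both differences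
  are polynomials in \<open>u = m\<close> with nonnegative coefficients. For \<open>l = 5\<close> the second difference
  is negative at \<open>m = 0\<close>, so the differences are expanded around 1.
\<close>

lemma peak_2:
  fixes m :: nat
  defines "a \<equiv> coeff (barbell_factor 2 (real m) * [:1, 1:] ^ (2 * m))"
  shows "a m \<le> a (m + 1)" and "a (m + 2) \<le> a (m + 1)"
proof -
  define u where "u = real m"
  have u0: "u \<ge> 0" by (simp add: u_def)
  obtain w R where w: "w \<ge> 0"
    and shift: "\<And>f i. coeff (f * [:1, 1:] ^ (2 * m)) i = coeff (f * R) (i + 4)"
    and R: "\<And>e. e \<le> 2 * 4 \<Longrightarrow>
      coeff R (m + e) = w * central_weight 4 u (if e \<le> 4 then 4 - e else e - 4)"
    using central_window[of m 4] unfolding u_def by metis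
  have ivl: "{i<..j} = (if i < j then insert j {i<..j - 1} else {})" for i j :: nat by auto
  have W: "central_weight 4 u 0 = (u + 1) * (u + 2) * (u + 3) * (u + 4)"
    "central_weight 4 u 1 = u * (u + 2) * (u + 3) * (u + 4)"
    "central_weight 4 u 2 = u * (u - 1) * (u + 3) * (u + 4)"
    "central_weight 4 u 3 = u * (u - 1) * (u - 2) * (u + 4)"
    "central_weight 4 u 4 = u * (u - 1) * (u - 2) * (u - 3)"
    by (simp_all add: central_weight_def ivl eval_nat_numeral)
  have window: "coeff R m = w * (u * (u - 1) * (u - 2) * (u - 3))"
    "coeff R (Suc m) = w * (u * (u - 1) * (u - 2) * (u + 4))"
    "coeff R (Suc (Suc m)) = w * (u * (u - 1) * (u + 3) * (u + 4))"
    "coeff R (Suc (Suc (Suc m))) = w * (u * (u + 2) * (u + 3) * (u + 4))"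
    "coeff R (Suc (Suc (Suc (Suc m)))) = w * ((u + 1) * (u + 2) * (u + 3) * (u + 4))"
    "coeff R (Suc (Suc (Suc (Suc (Suc m))))) = w * (u * (u + 2) * (u + 3) * (u + 4))"
    "coeff R (Suc (Suc (Suc (Suc (Suc (Suc m)))))) = w * (u * (u - 1) * (u + 3) * (u + 4))"
    "coeff R (Suc (Suc (Suc (Suc (Suc (Suc (Suc m))))))) = w * (u * (u - 1) * (u - 2) * (u + 4))"
    "coeff R (Suc (Suc (Suc (Suc (Suc (Suc (Suc (Suc m)))))))) = w * (u * (u - 1) * (u - 2) * (u - 3))"
    using R[of 0] R[of 1] R[of 2] R[of 3] R[of 4] R[of 5] R[of 6] R[of 7] R[of 8]
    by (simp_all add: W W(2)[unfolded One_nat_def], simp_all add: eval_nat_numeral)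
  have "a (m + 1) - a m = w * (33 * u^5 + 371 * u^4 + 1465 * u^3 + 2533 * u^2 + 1898 * u + 480)"
    unfolding a_def u_def[symmetric] shift barbell_factor_coeffs
    by (simp add: eval_nat_numeral window) (simp add: algebra_simps eval_nat_numeral)
  moreover have "0 \<le> w * (33 * u^5 + 371 * u^4 + 1465 * u^3 + 2533 * u^2 + 1898 * u + 480)"
    using w u0 by (intro mult_nonneg_nonneg add_nonneg_nonneg) auto
  ultimately show "a m \<le> a (m + 1)" by linarith
  have "a (m + 1) - a (m + 2) = w * (21 * u^5 + 217 * u^4 + 827 * u^3 + 1439 * u^2 + 1108 * u + 288)"
    unfolding a_def u_def[symmetric] shift barbell_factor_coeffs
    by (simp add: eval_nat_numeral window) (simp add: algebra_simps eval_nat_numeral)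
  moreover have "0 \<le> w * (21 * u^5 + 217 * u^4 + 827 * u^3 + 1439 * u^2 + 1108 * u + 288)"
    using w u0 by (intro mult_nonneg_nonneg add_nonneg_nonneg) auto
  ultimately show "a (m + 2) \<le> a (m + 1)" by linarith
qed

lemma peak_3:
  fixes m :: nat
  defines "a \<equiv> coeff (barbell_factor 3 (real m) * [:1, 1:] ^ (2 * m))"
  shows "a (m + 1) \<le> a (m + 2)" and "a (m + 3) \<le> a (m + 2)"
proof -
  define u where "u = real m"
  have u0: "u \<ge> 0" by (simp add: u_def)
  obtain w R where w: "w \<ge> 0"
    and shift: "\<And>f i. coeff (f * [:1, 1:] ^ (2 * m)) i = coeff (f * R) (i + 4)"
    and R: "\<And>e. e \<le> 2 * 4 \<Longrightarrow>
      coeff R (m + e) = w * central_weight 4 u (if e \<le> 4 then 4 - e else e - 4)"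
    using central_window[of m 4] unfolding u_def by metis
  have ivl: "{i<..j} = (if i < j then insert j {i<..j - 1} else {})" for i j :: nat by auto
  have W: "central_weight 4 u 0 = (u + 1) * (u + 2) * (u + 3) * (u + 4)"
    "central_weight 4 u 1 = u * (u + 2) * (u + 3) * (u + 4)"
    "central_weight 4 u 2 = u * (u - 1) * (u + 3) * (u + 4)"
    "central_weight 4 u 3 = u * (u - 1) * (u - 2) * (u + 4)"
    "central_weight 4 u 4 = u * (u - 1) * (u - 2) * (u - 3)"
    by (simp_all add: central_weight_def ivl eval_nat_numeral)
  have window: "coeff R m = w * (u * (u - 1) * (u - 2) * (u - 3))"
    "coeff R (Suc m) = w * (u * (u - 1) * (u - 2) * (u + 4))"
    "coeff R (Suc (Suc m)) = w * (u * (u - 1) * (u + 3) * (u + 4))"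
    "coeff R (Suc (Suc (Suc m))) = w * (u * (u + 2) * (u + 3) * (u + 4))"
    "coeff R (Suc (Suc (Suc (Suc m)))) = w * ((u + 1) * (u + 2) * (u + 3) * (u + 4))"
    "coeff R (Suc (Suc (Suc (Suc (Suc m))))) = w * (u * (u + 2) * (u + 3) * (u + 4))"
    "coeff R (Suc (Suc (Suc (Suc (Suc (Suc m)))))) = w * (u * (u - 1) * (u + 3) * (u + 4))"
    "coeff R (Suc (Suc (Suc (Suc (Suc (Suc (Suc m))))))) = w * (u * (u - 1) * (u - 2) * (u + 4))"
    "coeff R (Suc (Suc (Suc (Suc (Suc (Suc (Suc (Suc m)))))))) = w * (u * (u - 1) * (u - 2) * (u - 3))"
    using R[of 0] R[of 1] R[of 2] R[of 3] R[of 4] R[of 5] R[of 6] R[of 7] R[of 8]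
    by (simp_all add: W W(2)[unfolded One_nat_def], simp_all add: eval_nat_numeral)
  have "a (m + 2) - a (m + 1) = w * (15 * u^5 + 211 * u^4 + 997 * u^3 + 2027 * u^2 + 1730 * u + 480)"
    unfolding a_def u_def[symmetric] shift barbell_factor_coeffs
    by (simp add: eval_nat_numeral window) (simp add: algebra_simps eval_nat_numeral)
  moreover have "0 \<le> w * (15 * u^5 + 211 * u^4 + 997 * u^3 + 2027 * u^2 + 1730 * u + 480)"
    using w u0 by (intro mult_nonneg_nonneg add_nonneg_nonneg) auto
  ultimately show "a (m + 1) \<le> a (m + 2)" by linarith
  have "a (m + 2) - a (m + 3) = w * (235 * u^5 + 2245 * u^4 + 7787 * u^3 + 12329 * u^2 + 8784 * u + 2160)"
    unfolding a_def u_def[symmetric] shift barbell_factor_coeffs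
    by (simp add: eval_nat_numeral window) (simp add: algebra_simps eval_nat_numeral)
  moreover have "0 \<le> w * (235 * u^5 + 2245 * u^4 + 7787 * u^3 + 12329 * u^2 + 8784 * u + 2160)"
    using w u0 by (intro mult_nonneg_nonneg add_nonneg_nonneg) auto
  ultimately show "a (m + 3) \<le> a (m + 2)" by linarith
qed

lemma peak_4:
  fixes m :: nat
  defines "a \<equiv> coeff (barbell_factor 4 (real m) * [:1, 1:] ^ (2 * m))"
  shows "a (m + 1) \<le> a (m + 2)" and "a (m + 3) \<le> a (m + 2)"
proof -
  define u where "u = real m"
  have u0: "u \<ge> 0" by (simp add: u_def)
  obtain w R where w: "w \<ge> 0"
    and shift: "\<And>f i. coeff (f * [:1, 1:] ^ (2 * m)) i = coeff (f * R) (i + 5)"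
    and R: "\<And>e. e \<le> 2 * 5 \<Longrightarrow>
      coeff R (m + e) = w * central_weight 5 u (if e \<le> 5 then 5 - e else e - 5)"
    using central_window[of m 5] unfolding u_def by metis
  have ivl: "{i<..j} = (if i < j then insert j {i<..j - 1} else {})" for i j :: nat by auto
  have W: "central_weight 5 u 0 = (u + 1) * (u + 2) * (u + 3) * (u + 4) * (u + 5)"
    "central_weight 5 u 1 = u * (u + 2) * (u + 3) * (u + 4) * (u + 5)"
    "central_weight 5 u 2 = u * (u - 1) * (u + 3) * (u + 4) * (u + 5)"
    "central_weight 5 u 3 = u * (u - 1) * (u - 2) * (u + 4) * (u + 5)"
    "central_weight 5 u 4 = u * (u - 1) * (u - 2) * (u - 3) * (u + 5)"
    "central_weight 5 u 5 = u * (u - 1) * (u - 2) * (u - 3) * (u - 4)"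
    by (simp_all add: central_weight_def ivl eval_nat_numeral)
  have window: "coeff R m = w * (u * (u - 1) * (u - 2) * (u - 3) * (u - 4))"
    "coeff R (Suc m) = w * (u * (u - 1) * (u - 2) * (u - 3) * (u + 5))"
    "coeff R (Suc (Suc m)) = w * (u * (u - 1) * (u - 2) * (u + 4) * (u + 5))"
    "coeff R (Suc (Suc (Suc m))) = w * (u * (u - 1) * (u + 3) * (u + 4) * (u + 5))"
    "coeff R (Suc (Suc (Suc (Suc m)))) = w * (u * (u + 2) * (u + 3) * (u + 4) * (u + 5))"
    "coeff R (Suc (Suc (Suc (Suc (Suc m))))) = w * ((u + 1) * (u + 2) * (u + 3) * (u + 4) * (u + 5))"
    "coeff R (Suc (Suc (Suc (Suc (Suc (Suc m)))))) = w * (u * (u + 2) * (u + 3) * (u + 4) * (u + 5))"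
    "coeff R (Suc (Suc (Suc (Suc (Suc (Suc (Suc m))))))) = w * (u * (u - 1) * (u + 3) * (u + 4) * (u + 5))"
    "coeff R (Suc (Suc (Suc (Suc (Suc (Suc (Suc (Suc m)))))))) = w * (u * (u - 1) * (u - 2) * (u + 4) * (u + 5))"
    "coeff R (Suc (Suc (Suc (Suc (Suc (Suc (Suc (Suc (Suc m))))))))) = w * (u * (u - 1) * (u - 2) * (u - 3) * (u + 5))"
    "coeff R (Suc (Suc (Suc (Suc (Suc (Suc (Suc (Suc (Suc (Suc m)))))))))) = w * (u * (u - 1) * (u - 2) * (u - 3) * (u - 4))"
    using R[of 0] R[of 1] R[of 2] R[of 3] R[of 4] R[of 5] R[of 6] R[of 7] R[of 8] R[of 9] R[of 10]
    by (simp_all add: W W(2)[unfolded One_nat_def], simp_all add: eval_nat_numeral)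
  have "a (m + 2) - a (m + 1) = w * (544 * u^6 + 8360 * u^5 + 49160 * u^4 + 139750 * u^3 + 199656 * u^2 + 133890 * u + 31680)"
    unfolding a_def u_def[symmetric] shift barbell_factor_coeffs
    by (simp add: eval_nat_numeral window) (simp add: algebra_simps eval_nat_numeral)
  moreover have "0 \<le> w * (544 * u^6 + 8360 * u^5 + 49160 * u^4 + 139750 * u^3 + 199656 * u^2 + 133890 * u + 31680)"
    using w u0 by (intro mult_nonneg_nonneg add_nonneg_nonneg) auto
  ultimately show "a (m + 1) \<le> a (m + 2)" by linarith
  have "a (m + 2) - a (m + 3) = w * (560 * u^6 + 8120 * u^5 + 44884 * u^4 + 119898 * u^3 + 162288 * u^2 + 104290 * u + 24000)"
    unfolding a_def u_def[symmetric] shift barbell_factor_coeffs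
    by (simp add: eval_nat_numeral window) (simp add: algebra_simps eval_nat_numeral)
  moreover have "0 \<le> w * (560 * u^6 + 8120 * u^5 + 44884 * u^4 + 119898 * u^3 + 162288 * u^2 + 104290 * u + 24000)"
    using w u0 by (intro mult_nonneg_nonneg add_nonneg_nonneg) auto
  ultimately show "a (m + 3) \<le> a (m + 2)" by linarith
qed

lemma peak_5:
  fixes m :: nat
  assumes "1 \<le> m"
  defines "a \<equiv> coeff (barbell_factor 5 (real m) * [:1, 1:] ^ (2 * m))"
  shows "a (m + 1) \<le> a (m + 2)" and "a (m + 3) \<le> a (m + 2)"
proof -
  define u where "u = real m"
  obtain v where v: "u = 1 + v" "v \<ge> 0" using assms(1) that[of "u - 1"] by (simp add: u_def)
  obtain w R where w: "w \<ge> 0"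
    and shift: "\<And>f i. coeff (f * [:1, 1:] ^ (2 * m)) i = coeff (f * R) (i + 6)"
    and R: "\<And>e. e \<le> 2 * 6 \<Longrightarrow>
      coeff R (m + e) = w * central_weight 6 u (if e \<le> 6 then 6 - e else e - 6)"
    using central_window[of m 6] unfolding u_def by metis
  have ivl: "{i<..j} = (if i < j then insert j {i<..j - 1} else {})" for i j :: nat by auto
  have W: "central_weight 6 u 0 = (u + 1) * (u + 2) * (u + 3) * (u + 4) * (u + 5) * (u + 6)"
    "central_weight 6 u 1 = u * (u + 2) * (u + 3) * (u + 4) * (u + 5) * (u + 6)"
    "central_weight 6 u 2 = u * (u - 1) * (u + 3) * (u + 4) * (u + 5) * (u + 6)"
    "central_weight 6 u 3 = u * (u - 1) * (u - 2) * (u + 4) * (u + 5) * (u + 6)"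
    "central_weight 6 u 4 = u * (u - 1) * (u - 2) * (u - 3) * (u + 5) * (u + 6)"
    "central_weight 6 u 5 = u * (u - 1) * (u - 2) * (u - 3) * (u - 4) * (u + 6)"
    "central_weight 6 u 6 = u * (u - 1) * (u - 2) * (u - 3) * (u - 4) * (u - 5)"
    by (simp_all add: central_weight_def ivl eval_nat_numeral)
  have window: "coeff R m = w * (u * (u - 1) * (u - 2) * (u - 3) * (u - 4) * (u - 5))"
    "coeff R (Suc m) = w * (u * (u - 1) * (u - 2) * (u - 3) * (u - 4) * (u + 6))"
    "coeff R (Suc (Suc m)) = w * (u * (u - 1) * (u - 2) * (u - 3) * (u + 5) * (u + 6))"
    "coeff R (Suc (Suc (Suc m))) = w * (u * (u - 1) * (u - 2) * (u + 4) * (u + 5) * (u + 6))"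
    "coeff R (Suc (Suc (Suc (Suc m)))) = w * (u * (u - 1) * (u + 3) * (u + 4) * (u + 5) * (u + 6))"
    "coeff R (Suc (Suc (Suc (Suc (Suc m))))) = w * (u * (u + 2) * (u + 3) * (u + 4) * (u + 5) * (u + 6))"
    "coeff R (Suc (Suc (Suc (Suc (Suc (Suc m)))))) = w * ((u + 1) * (u + 2) * (u + 3) * (u + 4) * (u + 5) * (u + 6))"
    "coeff R (Suc (Suc (Suc (Suc (Suc (Suc (Suc m))))))) = w * (u * (u + 2) * (u + 3) * (u + 4) * (u + 5) * (u + 6))"
    "coeff R (Suc (Suc (Suc (Suc (Suc (Suc (Suc (Suc m)))))))) = w * (u * (u - 1) * (u + 3) * (u + 4) * (u + 5) * (u + 6))"
    "coeff R (Suc (Suc (Suc (Suc (Suc (Suc (Suc (Suc (Suc m))))))))) = w * (u * (u - 1) * (u - 2) * (u + 4) * (u + 5) * (u + 6))"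
    "coeff R (Suc (Suc (Suc (Suc (Suc (Suc (Suc (Suc (Suc (Suc m)))))))))) = w * (u * (u - 1) * (u - 2) * (u - 3) * (u + 5) * (u + 6))"
    "coeff R (Suc (Suc (Suc (Suc (Suc (Suc (Suc (Suc (Suc (Suc (Suc m))))))))))) = w * (u * (u - 1) * (u - 2) * (u - 3) * (u - 4) * (u + 6))"
    "coeff R (Suc (Suc (Suc (Suc (Suc (Suc (Suc (Suc (Suc (Suc (Suc (Suc m)))))))))))) = w * (u * (u - 1) * (u - 2) * (u - 3) * (u - 4) * (u - 5))"
    using R[of 0] R[of 1] R[of 2] R[of 3] R[of 4] R[of 5] R[of 6] R[of 7] R[of 8] R[of 9] R[of 10] R[of 11] R[of 12]
    by (simp_all add: W W(2)[unfolded One_nat_def], simp_all add: eval_nat_numeral)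
  have "a (m + 2) - a (m + 1) = w * (4373 * v^7 + 118493 * v^6 + 1318525 * v^5 + 7797541 * v^4 + 26454714 * v^3 + 51520686 * v^2 + 53366388 * v + 22674960)"
    unfolding a_def u_def[symmetric] shift barbell_factor_coeffs
    by (simp add: eval_nat_numeral window) (simp add: v(1) algebra_simps eval_nat_numeral)
  moreover have "0 \<le> w * (4373 * v^7 + 118493 * v^6 + 1318525 * v^5 + 7797541 * v^4 + 26454714 * v^3 + 51520686 * v^2 + 53366388 * v + 22674960)"
    using w v(2) by (intro mult_nonneg_nonneg add_nonneg_nonneg) auto
  ultimately show "a (m + 1) \<le> a (m + 2)" by linarith
  have "a (m + 2) - a (m + 3) = w * (377 * v^7 + 9323 * v^6 + 91885 * v^5 + 460903 * v^4 + 1244934 * v^3 + 1752414 * v^2 + 1102164 * v + 176400)"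
    unfolding a_def u_def[symmetric] shift barbell_factor_coeffs
    by (simp add: eval_nat_numeral window) (simp add: v(1) algebra_simps eval_nat_numeral)
  moreover have "0 \<le> w * (377 * v^7 + 9323 * v^6 + 91885 * v^5 + 460903 * v^4 + 1244934 * v^3 + 1752414 * v^2 + 1102164 * v + 176400)"
    using w v(2) by (intro mult_nonneg_nonneg add_nonneg_nonneg) auto
  ultimately show "a (m + 3) \<le> a (m + 2)" by linarith
qed

section \<open>Unimodality for barbell graphs\<close>

lemma barbell_peak:
  assumes "l \<in> {2, 3, 4, 5}" and "l = 5 \<Longrightarrow> 1 \<le> m"
  defines "a \<equiv> coeff (barbell_factor l (real m) * [:1, 1:] ^ (2 * m))"
    and "k \<equiv> (if l = 2 then m + 1 else m + 2)"
  shows "a (k - 1) \<le> a k" and "a (k + 1) \<le> a k"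
proof -
  have "a (k - 1) \<le> a k \<and> a (k + 1) \<le> a k"
  proof (cases "l = 2")
    case True
    then show ?thesis using peak_2[of m] unfolding a_def k_def by simp
  next
    case False
    then have "a (m + 1) \<le> a (m + 2) \<and> a (m + 3) \<le> a (m + 2)"
      using assms(1,2) peak_3[of m] peak_4[of m] peak_5[of m] unfolding a_def by blast
    then show ?thesis using False by (simp add: k_def numeral_3_eq_3)
  qed
  then show "a (k - 1) \<le> a k" and "a (k + 1) \<le> a k" by auto
qed

text \<open>
  At \<open>t = 1\<close> the outer layers are empty and the quotient matrix is too large by two rows, which
  shows as the factor \<open>(1 + x) ^ 2\<close>. What is left is the characteristic polynomial of a path.
\<close>

lemma barbell_factor_at_minus_1:
  "barbell_factor 2 (-1) = - ([:1, 1:] ^ 2 * [:-1, 0, 1:])"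
  "barbell_factor 3 (-1) = - ([:1, 1:] ^ 2 * [:-4, -6, 0, 1:])"
  "barbell_factor 4 (-1) = - ([:1, 1:] ^ 2 * [:-12, -32, -20, 0, 1:])"
  unfolding barbell_factor_coeffs power2_eq_square by simp_all

theorem theorem4p7:
  fixes G :: "('a, 'b) pre_digraph" and t l n :: nat and vs :: "'a list" and c :: "nat \<Rightarrow> real"
  assumes "barbell_graph t l G"
    and "l \<in> {2, 3, 4, 5}"
    and "l = 5 \<Longrightarrow> t \<ge> 3"
    and "n = card (verts G)"
    and "distinct vs" and "set vs = verts G"
    and "\<And>i. c i = coeff (det_minus_x (distance_matrix G vs)) i"
  shows "n = 2 * t + l - 2 \<and>
         unimodal_with_peak (\<lambda>i. (-1) ^ (n - 1) * c i) (n - 2) (if l = 2 then t - 1 else t)"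
proof -
  obtain lay :: "'a \<Rightarrow> nat"
    where le: "\<And>v. v \<in> verts G \<Longrightarrow> lay v \<le> l + 1"
    and adj: "\<And>u v. u \<in> verts G \<Longrightarrow> v \<in> verts G \<Longrightarrow>
      (u, v) \<in> arcs_ends G \<longleftrightarrow> u \<noteq> v \<and> lay u \<le> lay v + 1 \<and> lay v \<le> lay u + 1"
    and card: "\<And>j. j \<le> l + 1 \<Longrightarrow> card {v \<in> verts G. lay v = j} = (if j = 0 \<or> j = l + 1 then t - 1 else 1)"
    and t: "1 \<le> t" and l: "2 \<le> l"
    by (rule barbell_layers[OF assms(1)], rule that)
  interpret graph G using assms(1) by (simp add: barbell_graph_def)
  have wf: "wf_digraph G" by unfold_locales
  have inhabited: "\<exists>w\<in>verts G. lay w = j" if "v \<in> verts G" "lay u < j" "j < lay v" for u v j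
  proof -
    have "card {v \<in> verts G. lay v = j} = 1" using card[of j] le[OF that(1)] that by auto
    then have "{v \<in> verts G. lay v = j} \<noteq> {}" by force
    then show ?thesis by blast
  qed
  have dist: "graph_dist G u v = layer_dist (lay u) (lay v) + (if lay u = lay v \<and> u \<noteq> v then 1 else 0)"
    if "u \<in> verts G" "v \<in> verts G" for u v
    by (rule layered_distance[OF wf adj inhabited that])
  have n: "n = 2 * t + l - 2"
  proof -
    have "verts G = (\<Union>j\<in>{..l + 1}. {v \<in> verts G. lay v = j})" using le by auto
    then have "n = (\<Sum>j\<le>l + 1. card {v \<in> verts G. lay v = j})"
      using card_UN_disjoint[of "{..l + 1}" "\<lambda>j. {v \<in> verts G. lay v = j}"] assms(4) by auto
    also have "\<dots> = (\<Sum>j\<le>l + 1. if j = 0 \<or> j = l + 1 then t - 1 else 1)"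
      by (rule sum.cong) (simp_all add: card)
    also have "\<dots> = 2 * t + l - 2"
      using assms(2) t by (auto simp: eval_nat_numeral)
    finally show ?thesis .
  qed
  have len: "length vs = n" using assms(4-6) distinct_card by metis
  define D where "D = distance_matrix G vs"
  have D: "D \<in> carrier_mat n n" by (simp add: D_def distance_matrix_def len)
  define u where "u = real t - 2"
  have s: "real (t - 1) = u + 1" using t by (simp add: u_def of_nat_diff)
  have c: "(-1) ^ (n - 1) * c i = - coeff (char_poly D) i" for i
  proof -
    have "(-1 :: real) ^ k * (-1) ^ Suc k = -1" for k
      by (simp add: power_mult_distrib[symmetric])
    moreover have "Suc (n - 1) = n" using n t l by simp
    ultimately have "(-1 :: real) ^ (n - 1) * (-1) ^ n = -1" by metis
    moreover have "coeff ((-1) ^ n * char_poly D) i = (-1) ^ n * coeff (char_poly D) i"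
      by (cases "even n") simp_all
    ultimately show ?thesis
      unfolding assms(7) D_def[symmetric] det_minus_x_eq[OF D] by (metis mult.assoc mult_minus1)
  qed
  have chi: "[:1, 1:] ^ (l + 2) * char_poly D = - ([:1, 1:] ^ n * barbell_factor l u)"
  proof -
    have lin: "poly [:1, 1:] x = x + 1" for x :: real by simp
    have "poly ([:1, 1:] ^ (l + 2) * char_poly D) x = poly (- ([:1, 1:] ^ n * barbell_factor l u)) x" for x
    proof -
      have "(x + 1) ^ (l + 2) * poly (char_poly D) x
        = (x + 1) ^ n * det (mat (l + 2) (l + 2) (\<lambda>(i, j). layer_entry l (real (t - 1)) (x + 1) i j))"
        using layered_char_poly[OF assms(5), of G lay l "t - 1" x] dist le card
        unfolding assms(6) len D_def by simp
      also have "\<dots> = - ((x + 1) ^ n * poly (barbell_factor l u) x)"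
        unfolding s layer_det_eq_barbell_factor[OF assms(2)] by simp
      finally show ?thesis
        using lin[of x] by (simp only: poly_mult poly_power poly_minus)
    qed
    then show ?thesis using poly_eq_poly_eq_iff by blast
  qed
  have "unimodal_with_peak (\<lambda>i. - coeff (char_poly D) i) (n - 2) (if l = 2 then t - 1 else t)"
  proof (cases "t = 1")
    case True
    have nl: "n = l" and u1: "u = -1" using True n by (simp_all add: u_def)
    have nz: "[:1, 1:] ^ n \<noteq> (0 :: real poly)" by simp
    have "[:1, 1:] ^ n * ([:1, 1:] ^ 2 * char_poly D) = [:1, 1:] ^ n * (- barbell_factor l (-1))"
      using chi unfolding nl u1 power_add mult.assoc mult_minus_right .
    then have chi1: "[:1, 1:] ^ 2 * char_poly D = - barbell_factor l (-1)" using nz mult_left_cancel by blast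
    have cancel: "char_poly D = q" if "- barbell_factor l (-1) = [:1, 1:] ^ 2 * q" for q
      using chi1 that by simp
    have "l \<noteq> 5" using assms(3) True by auto
    then consider "l = 2" | "l = 3" | "l = 4" using assms(2) by auto
    then show ?thesis
    proof cases
      case 1
      then have "char_poly D = [:-1, 0, 1:]" using barbell_factor_at_minus_1(1) by (intro cancel) simp
      then show ?thesis using 1 True n by (simp add: unimodal_with_peak_def)
    next
      case 2
      then have "char_poly D = [:-4, -6, 0, 1:]" using barbell_factor_at_minus_1(2) by (intro cancel) simp
      then show ?thesis using 2 True n by (auto simp: unimodal_with_peak_def le_Suc_eq)
    next
      case 3
      then have "char_poly D = [:-12, -32, -20, 0, 1:]" using barbell_factor_at_minus_1(3) by (intro cancel) simp
      then show ?thesis using 3 True n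
        by (auto simp: unimodal_with_peak_def le_Suc_eq less_Suc_eq eval_nat_numeral)
    qed
  next
    case False
    define m where "m = t - 2"
    have m: "t = m + 2" "u = real m" "n = 2 * m + (l + 2)" using False t n l by (auto simp: m_def u_def)
    define a where "a = coeff (barbell_factor l (real m) * [:1, 1:] ^ (2 * m))"
    have "[:1, 1 :: real:] ^ n = [:1, 1:] ^ (2 * m) * [:1, 1:] ^ (l + 2)" unfolding m(3) by (rule power_add)
    then have "[:1, 1:] ^ (l + 2) * char_poly D = [:1, 1:] ^ (l + 2) * - (barbell_factor l (real m) * [:1, 1:] ^ (2 * m))"
      unfolding chi m(2) by (simp only: mult_minus_right mult.assoc mult.commute mult.left_commute)
    moreover have nz: "[:1, 1:] ^ (l + 2) \<noteq> (0 :: real poly)" by (rule power_not_zero) simp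
    ultimately have "char_poly D = - (barbell_factor l (real m) * [:1, 1:] ^ (2 * m))"
      using mult_left_cancel[of "[:1, 1:] ^ (l + 2) :: real poly"] nz by blast
    then have chi_a: "(\<lambda>i. - coeff (char_poly D) i) = a" by (simp only: a_def coeff_minus minus_minus)
    have sym: "D $$ (i, j) = D $$ (j, i)" if "i < n" "j < n" for i j
    proof -
      have "vs ! i \<in> verts G" "vs ! j \<in> verts G" using that len assms(6) nth_mem by blast+
      then show ?thesis
        using that len by (simp add: D_def distance_matrix_def dist layer_dist_def add.commute eq_commute)
    qed
    have "unimodal_with_peak a (n - 2) (if l = 2 then m + 1 else m + 2)"
    proof (rule log_concave_unimodal)
      fix i assume "i \<le> n - 2"
      then show "0 < a i" unfolding a_def using m(3) by (intro barbell_factor_coeffs_pos assms(2)) simp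
    next
      fix i assume i: "i + 2 \<le> n - 2"
      have "real (i + 2) * (a i * a (i + 2)) \<le> real (i + 1) * (a (i + 1))\<^sup>2"
        using newton_inequality[OF symmetric_char_poly_real_rooted[OF D sym], of i]
        unfolding chi_a[symmetric] by simp
      also have "\<dots> \<le> real (i + 2) * (a (i + 1))\<^sup>2" by (intro mult_right_mono) auto
      finally show "a i * a (i + 2) \<le> (a (i + 1))\<^sup>2" by (simp add: mult_le_cancel_left)
    next
      show "(if l = 2 then m + 1 else m + 2) \<le> n - 2" using m(3) l by simp
    qed (use barbell_peak[of l m] assms(2,3) m(1) in \<open>simp_all add: a_def del: mult_pCons_left mult_pCons_right\<close>)
    then show ?thesis unfolding chi_a m(1) by (auto split: if_splits)
  qed
  then show ?thesis unfolding c using n by simp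
qed

end
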